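(* Let $(X,\mu)$ be a $\sigma$-finite measure space, $\mathcal{Y}_1,\dots,\mathcal{Y}_d$ normed lattices, and $T_j:\mathcal{Y}_j\to\mathcal{M}(X)$ positive linear maps, each of which saturates $X$. Let $\alpha_j>0$ with $\sum_{j=1}^d\alpha_j=1$, let $0<q<1$, and suppose that for some $A\ge0$ $$\Big\|\prod_{j=1}^d (T_jf_j)^{\alpha_j}\Big\|_{L^q(X)}\le A\prod_{j=1}^d\|f_j\|_{\mathcal{Y}_j}^{\alpha_j}$$ for all nonnegative $f_j\in\mathcal{Y}_j$, $1\le j\le d$. Then there exist nonnegative measurable functions $g_1,\dots,g_d$ on $X$ such that $$\Big\|\prod_{j=1}^d g_j^{\alpha_j}\Big\|_{L^{q'}(X)}=1$$ and such that for each $j$, $$\int_X g_j(x)\,T_jf_j(x)\,d\mu(x)\le A\,\|f_j\|_{\mathcal{Y}_j}$$ for all nonnegative $f_j\in\mathcal{Y}_j$.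
   Context: $\mathcal{M}(X)$ is the class of real-valued measurable functions on $X$. A normed lattice is a real vector lattice with a norm satisfying $\|f\|\le\|g\|$ whenever $|f|\le|g|$. $T:\mathcal{Y}\to\mathcal{M}(X)$ is positive if $f\ge0$ implies $Tf\ge0$ a.e. $T$ saturates $X$ if for each measurable $E\subseteq X$ of positive measure there exist a measurable $E'\subseteq E$ with $\mu(E')>0$ and a nonnegative $h\in\mathcal{Y}$ such that $Th>0$ a.e. on $E'$. For $0<q<1$, $q'=q/(q-1)<0$ is defined by $1/q+1/q'=1$, and for nonnegative $g$, $\|g\|_{L^{q'}(X)}=\left(\int_X g^{q'}\,d\mu\right)^{1/q'}$; in particular $\|g\|_{L^{q'}}=1$ entails $g>0$ a.e.
   Formalization: The formal theorem additionally assumes μ(X) > 0; if μ(X) = 0 all hypotheses hold, but ∫ g^{q'} dμ = 0 for every g, so the L^{q'} norm is 0^{1/q'} = ∞ and can never equal 1. *)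

theory Defs
  imports
    "HOL-Analysis.Analysis"
    "HOL-Algebra.Lattice"
    "HOL-Algebra.Module"
    "HOL-Algebra.Algebraic_Closure_Type"
begin

text \<open>
  A theorem about several normed lattices of different nature cannot use a type class for them,
  as all members of an indexed family would then be the same space. They are therefore records with
  a carrier: a module over the reals together with an order relation and a norm. The ring
  multiplication and unit that the library's module record contains are not used.
\<close>

record 'b normed_vlattice = "(real, 'b) module" +
  vle :: "'b \<Rightarrow> 'b \<Rightarrow> bool"
  vnorm :: "'b \<Rightarrow> real"

definition vorder :: "'b normed_vlattice \<Rightarrow> 'b gorder" where
  "vorder Y = \<lparr>carrier = carrier Y, eq = (=), le = vle Y\<rparr>"

definition vabs :: "'b normed_vlattice \<Rightarrow> 'b \<Rightarrow> 'b" where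
  "vabs Y f = f \<squnion>\<^bsub>vorder Y\<^esub> (\<ominus>\<^bsub>Y\<^esub> f)"

definition positive_cone :: "'b normed_vlattice \<Rightarrow> 'b set" where
  "positive_cone Y = {f \<in> carrier Y. vle Y \<zero>\<^bsub>Y\<^esub> f}"

locale normed_lattice =
  Module.module "ring_of_type_algebra :: real ring" Y + Lattice.lattice "vorder Y"
  for Y :: "'b normed_vlattice" +
  assumes vle_add:
      "\<lbrakk>f \<in> carrier Y; g \<in> carrier Y; h \<in> carrier Y; vle Y f g\<rbrakk>
        \<Longrightarrow> vle Y (f \<oplus>\<^bsub>Y\<^esub> h) (g \<oplus>\<^bsub>Y\<^esub> h)"
    and vle_smult:
      "\<lbrakk>f \<in> carrier Y; g \<in> carrier Y; 0 \<le> c; vle Y f g\<rbrakk>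
        \<Longrightarrow> vle Y (c \<odot>\<^bsub>Y\<^esub> f) (c \<odot>\<^bsub>Y\<^esub> g)"
    and vnorm_nonneg: "f \<in> carrier Y \<Longrightarrow> 0 \<le> vnorm Y f"
    and vnorm_eq_0: "f \<in> carrier Y \<Longrightarrow> vnorm Y f = 0 \<longleftrightarrow> f = \<zero>\<^bsub>Y\<^esub>"
    and vnorm_smult: "f \<in> carrier Y \<Longrightarrow> vnorm Y (c \<odot>\<^bsub>Y\<^esub> f) = \<bar>c\<bar> * vnorm Y f"
    and vnorm_triangle:
      "\<lbrakk>f \<in> carrier Y; g \<in> carrier Y\<rbrakk> \<Longrightarrow> vnorm Y (f \<oplus>\<^bsub>Y\<^esub> g) \<le> vnorm Y f + vnorm Y g"
    and vnorm_mono: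
      "\<lbrakk>f \<in> carrier Y; g \<in> carrier Y; vle Y (vabs Y f) (vabs Y g)\<rbrakk> \<Longrightarrow> vnorm Y f \<le> vnorm Y g"

text \<open>
  Measurable functions are identified when they agree almost everywhere, so a map into the space of
  measurable functions is given by a choice of representatives and its linearity is an identity
  almost everywhere.
\<close>

definition positive_linear_map ::
    "'a measure \<Rightarrow> 'b normed_vlattice \<Rightarrow> ('b \<Rightarrow> 'a \<Rightarrow> real) \<Rightarrow> bool" where
  "positive_linear_map M Y T \<longleftrightarrow>
    (\<forall>f\<in>carrier Y. T f \<in> borel_measurable M) \<and>
    (\<forall>f\<in>carrier Y. \<forall>g\<in>carrier Y. AE x in M. T (f \<oplus>\<^bsub>Y\<^esub> g) x = T f x + T g x) \<and>
    (\<forall>c. \<forall>f\<in>carrier Y. AE x in M. T (c \<odot>\<^bsub>Y\<^esub> f) x = c * T f x) \<and>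
    (\<forall>f\<in>positive_cone Y. AE x in M. 0 \<le> T f x)"

definition saturates ::
    "'a measure \<Rightarrow> 'b normed_vlattice \<Rightarrow> ('b \<Rightarrow> 'a \<Rightarrow> real) \<Rightarrow> bool" where
  "saturates M Y T \<longleftrightarrow>
    (\<forall>E\<in>sets M. emeasure M E > 0 \<longrightarrow>
      (\<exists>E'\<in>sets M. E' \<subseteq> E \<and> emeasure M E' > 0 \<and>
        (\<exists>h\<in>positive_cone Y. AE x in M. x \<in> E' \<longrightarrow> 0 < T h x)))"

text \<open>
  Powers with values in \<open>[0, \<infinity>]\<close>. For a negative exponent \<open>0\<close> is sent to \<open>\<infinity>\<close> and \<open>\<infinity>\<close> to \<open>0\<close>; the
  real power function, for which \<open>0 powr p = 0\<close>, would hide the zeros of a function in its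
  \<open>L\<^sup>p\<close> norm.
\<close>

definition epowr :: "ennreal \<Rightarrow> real \<Rightarrow> ennreal" where
  "epowr t p =
    (if p = 0 then 1
     else if t = 0 then (if 0 < p then 0 else \<infinity>)
     else if t = \<infinity> then (if 0 < p then \<infinity> else 0)
     else ennreal (enn2real t powr p))"

text \<open>For a nonnegative function \<open>g\<close> and a real exponent \<open>p \<noteq> 0\<close> of either sign.\<close>

definition Lp_norm :: "'a measure \<Rightarrow> real \<Rightarrow> ('a \<Rightarrow> real) \<Rightarrow> ennreal" where
  "Lp_norm M p g = epowr (\<integral>\<^sup>+x. epowr (ennreal (g x)) p \<partial>M) (1 / p)"

end

theory Submission
  imports Defs
begin

text \<open>
  The functions \<open>g\<^sub>j\<close> are Lagrange multipliers of a maximisation problem. For a tuple \<open>u\<close> of nonnegative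
  functions put \<open>\<Phi>(u) = \<integral> \<phi>(u)\<close> with \<open>\<phi>(u) = \<Prod>\<^sub>j u\<^sub>j powr (q \<alpha>\<^sub>j)\<close>, and maximise \<open>\<Phi>\<close> over the convex set
  of tuples \<open>(T\<^sub>j f\<^sub>j)\<^sub>j\<close> with \<open>f\<^sub>j\<close> positive and \<open>\<Sum>\<^sub>j \<alpha>\<^sub>j \<parallel>f\<^sub>j\<parallel> \<le> 1\<close>. The hypothesis and the inequality of
  arithmetic and geometric means bound the supremum \<open>S\<close> by \<open>A powr q\<close>. If \<open>u\<close> is a maximiser, then
  differentiating \<open>\<Phi>(u + t v) \<le> (1 + t) powr q * S\<close> at \<open>t = 0\<close> gives
  \<open>\<integral> \<phi>(u) \<Sum>\<^sub>j q \<alpha>\<^sub>j v\<^sub>j / u\<^sub>j \<le> q S\<close> for all competitors \<open>v\<close>. Competitors with a single nonzero component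
  show that \<open>g\<^sub>j = c \<phi>(u) / u\<^sub>j\<close> satisfies the required estimates, and
  \<open>\<Prod>\<^sub>j g\<^sub>j powr \<alpha>\<^sub>j\<close> is \<open>c\<close> times a power of \<open>\<phi>(u)\<close>, whose norm is \<open>1\<close> for \<open>c = S powr ((1 - q) / q)\<close>;
  then \<open>c S = S powr (1 / q) \<le> A\<close>.

  The supremum need not be attained, so a maximiser is sought among the
  pointwise limits of competitors.
  What makes a maximising sequence \<open>U n\<close> converge is that the exponents \<open>q \<alpha>\<^sub>j\<close> add up to
  \<open>q < 1\<close>: the integrand \<open>\<phi>\<close> is then strictly concave on the open orthant, also along rays, and
  \<open>weighted_prod_gap\<close> bounds the relative distance of two points by the concavity gap at their midpoint.
  The gaps of consecutive members of a maximising sequence have small integrals, so \<open>\<phi>(U n)\<close> converges in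
  \<open>L\<^sup>1\<close> and almost everywhere to some \<open>F\<close>, and each \<open>U n j\<close> converges to a positive finite limit wherever
  \<open>F > 0\<close> (\<open>maximizing_sequence_converges\<close>). Saturation excludes zeros of \<open>F\<close> on a set of positive
  measure: adding \<open>t v\<close> with \<open>v > 0\<close> there would gain an amount of order \<open>t powr q\<close>, while only
  order \<open>t\<close> is possible (\<open>limit_positive\<close>). Fatou's lemma then transfers the first order condition to the
  limit (\<open>extremal_point\<close>).
\<close>

section \<open>Weighted products and their midpoint concavity\<close>

text \<open>Since \<open>0 powr b = 0\<close> for every \<open>b\<close>, a vanishing factor annihilates the product.\<close>

definition weighted_prod :: "'i set \<Rightarrow> ('i \<Rightarrow> real) \<Rightarrow> ('i \<Rightarrow> real) \<Rightarrow> real" where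
  "weighted_prod J b y = (\<Prod>j\<in>J. y j powr b j)"

lemma weighted_prod_nonneg: "0 \<le> weighted_prod J b y"
  by (simp add: weighted_prod_def prod_nonneg)

lemma weighted_prod_pos: "(\<And>j. j \<in> J \<Longrightarrow> 0 < y j) \<Longrightarrow> 0 < weighted_prod J b y"
  by (force simp: weighted_prod_def intro!: prod_pos)

lemma weighted_prod_eq_0:
  "finite J \<Longrightarrow> j \<in> J \<Longrightarrow> y j = 0 \<Longrightarrow> weighted_prod J b y = 0"
  by (auto simp: weighted_prod_def)

lemma weighted_prod_cong:
  "(\<And>j. j \<in> J \<Longrightarrow> x j = y j) \<Longrightarrow> weighted_prod J b x = weighted_prod J b y"
  by (simp add: weighted_prod_def)

lemma weighted_prod_mult:
  assumes "\<And>j. j \<in> J \<Longrightarrow> 0 \<le> x j" "\<And>j. j \<in> J \<Longrightarrow> 0 \<le> y j"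
  shows "weighted_prod J b (\<lambda>j. x j * y j) = weighted_prod J b x * weighted_prod J b y"
  unfolding weighted_prod_def prod.distrib[symmetric]
  by (rule prod.cong) (use assms in \<open>auto simp: powr_mult\<close>)

lemma weighted_prod_scale:
  assumes "finite J" "0 < s" "\<And>j. j \<in> J \<Longrightarrow> 0 \<le> y j"
  shows "weighted_prod J b (\<lambda>j. s * y j) = s powr (\<Sum>j\<in>J. b j) * weighted_prod J b y"
  using assms by (subst weighted_prod_mult) (auto simp: weighted_prod_def powr_sum)

lemma weighted_prod_mono:
  assumes "\<And>j. j \<in> J \<Longrightarrow> 0 \<le> x j" "\<And>j. j \<in> J \<Longrightarrow> x j \<le> y j" "\<And>j. j \<in> J \<Longrightarrow> 0 \<le> b j"
  shows "weighted_prod J b x \<le> weighted_prod J b y"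
  unfolding weighted_prod_def using assms by (intro prod_mono) (auto intro: powr_mono2)

lemma weighted_prod_eq_exp:
  assumes "finite J" "\<And>j. j \<in> J \<Longrightarrow> 0 < y j"
  shows "weighted_prod J b y = exp (\<Sum>j\<in>J. b j * ln (y j))"
  unfolding weighted_prod_def exp_sum[OF assms(1)]
  using assms by (intro prod.cong) (auto simp: powr_def order_less_imp_not_eq2)

text \<open>
  The missing weight \<open>1 - \<Sum> b\<close> is carried by an additional factor \<open>1\<close>. The proof sums
  \<open>ln z \<le> z - 1\<close> at \<open>z = y\<^sub>j / W\<close> and \<open>z = 1 / W\<close>, where \<open>W\<close> is the right-hand side.
\<close>

lemma weighted_am_gm:
  assumes fin: "finite J" and b: "\<And>j. j \<in> J \<Longrightarrow> 0 \<le> b j" and sum: "(\<Sum>j\<in>J. b j) \<le> 1"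
    and y: "\<And>j. j \<in> J \<Longrightarrow> 0 \<le> y j"
  shows "weighted_prod J b y \<le> (\<Sum>j\<in>J. b j * y j) + (1 - (\<Sum>j\<in>J. b j))"
proof (cases "\<exists>j\<in>J. y j = 0")
  case True
  then have "weighted_prod J b y = 0" using fin by (auto simp: weighted_prod_def)
  moreover have "0 \<le> (\<Sum>j\<in>J. b j * y j)" using b y by (intro sum_nonneg) auto
  ultimately show ?thesis using sum by simp
next
  case False
  then have pos: "0 < y j" if "j \<in> J" for j using y[OF that] that by force
  define W where "W = (\<Sum>j\<in>J. b j * y j) + (1 - (\<Sum>j\<in>J. b j))"
  have nn: "0 \<le> (\<Sum>j\<in>J. b j * y j)" using b y by (intro sum_nonneg) auto
  have W: "0 < W"
  proof (rule ccontr)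
    assume "\<not> 0 < W"
    then have s: "(\<Sum>j\<in>J. b j * y j) = 0" "(\<Sum>j\<in>J. b j) = 1" using nn sum by (auto simp: W_def)
    then have "\<forall>j\<in>J. b j * y j = 0" using b y fin by (subst (asm) sum_nonneg_eq_0_iff) auto
    then have "\<forall>j\<in>J. b j = 0" using pos by (metis less_irrefl mult_eq_0_iff)
    then show False using s(2) by simp
  qed
  have "(\<Sum>j\<in>J. b j * ln (y j)) - ln W
      = (\<Sum>j\<in>J. b j * ln (y j / W)) + (1 - (\<Sum>j\<in>J. b j)) * ln (1 / W)"
  proof -
    have "(\<Sum>j\<in>J. b j * ln (y j / W)) = (\<Sum>j\<in>J. b j * ln (y j) - b j * ln W)"
    proof (rule sum.cong[OF refl])
      fix j assume "j \<in> J"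
      then show "b j * ln (y j / W) = b j * ln (y j) - b j * ln W"
        using W pos[of j] by (simp add: ln_div right_diff_distrib)
    qed
    also have "\<dots> = (\<Sum>j\<in>J. b j * ln (y j)) - (\<Sum>j\<in>J. b j) * ln W"
      by (simp add: sum_subtractf sum_distrib_right)
    finally show ?thesis using W by (simp add: ln_div algebra_simps)
  qed
  also have "\<dots> \<le> (\<Sum>j\<in>J. b j * (y j / W - 1)) + (1 - (\<Sum>j\<in>J. b j)) * (1 / W - 1)"
    using W pos b sum by (intro add_mono sum_mono mult_left_mono ln_le_minus_one) auto
  also have "\<dots> = ((\<Sum>j\<in>J. b j * y j) + (1 - (\<Sum>j\<in>J. b j))) / W - 1"
    by (simp add: algebra_simps sum_subtractf add_divide_distrib diff_divide_distrib sum_divide_distrib)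
  also have "\<dots> = 0" using W by (simp add: W_def[symmetric])
  finally have "(\<Sum>j\<in>J. b j * ln (y j)) \<le> ln W" by simp
  then have "exp (\<Sum>j\<in>J. b j * ln (y j)) \<le> W" using W by (simp add: ln_ge_iff)
  then show ?thesis using weighted_prod_eq_exp[OF fin pos] by (simp add: W_def)
qed

lemma sum_weighted_square_le:
  fixes b s :: "'i \<Rightarrow> real"
  assumes b: "\<And>j. j \<in> J \<Longrightarrow> 0 \<le> b j"
  shows "(\<Sum>j\<in>J. b j * s j)\<^sup>2 \<le> (\<Sum>j\<in>J. b j) * (\<Sum>j\<in>J. b j * (s j)\<^sup>2)"
proof -
  have "(\<Sum>j\<in>J. b j * s j)\<^sup>2 = (\<Sum>j\<in>J. sqrt (b j) * (sqrt (b j) * s j))\<^sup>2"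
    using b by (intro arg_cong[where f="\<lambda>x. x\<^sup>2"] sum.cong) auto
  also have "\<dots> \<le> (\<Sum>j\<in>J. (sqrt (b j))\<^sup>2) * (\<Sum>j\<in>J. (sqrt (b j) * s j)\<^sup>2)"
    by (rule Cauchy_Schwarz_ineq_sum)
  also have "\<dots> = (\<Sum>j\<in>J. b j) * (\<Sum>j\<in>J. b j * (s j)\<^sup>2)"
    using b by (intro arg_cong2[where f="(*)"] sum.cong) (auto simp: power_mult_distrib)
  finally show ?thesis .
qed

text \<open>
  The inequality of arithmetic and geometric means with a quadratic remainder: applied to the square
  roots \<open>y\<^sub>j\<close> of the \<open>1 + t\<^sub>j\<close> and then squared, it gains the variance of the \<open>y\<^sub>j\<close>, computed with the
  additional value \<open>1\<close> of weight \<open>1 - \<Sum> b\<close>. That weight keeps the variance from vanishing when all \<open>t\<^sub>j\<close>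
  are equal and nonzero.
\<close>

lemma weighted_prod_le_quadratic:
  assumes fin: "finite J" and b: "\<And>j. j \<in> J \<Longrightarrow> 0 \<le> b j" and sum: "(\<Sum>j\<in>J. b j) \<le> 1"
    and t: "\<And>j. j \<in> J \<Longrightarrow> \<bar>t j\<bar> \<le> 1"
  shows "weighted_prod J b (\<lambda>j. 1 + t j)
    \<le> 1 + (\<Sum>j\<in>J. b j * t j) - (1 - (\<Sum>j\<in>J. b j)) / 9 * (\<Sum>j\<in>J. b j * (t j)\<^sup>2)"
proof -
  define q where "q = (\<Sum>j\<in>J. b j)"
  define y where "y j = sqrt (1 + t j)" for j
  define s where "s j = y j - 1" for j
  have q: "q \<le> 1" using sum by (simp add: q_def)
  have y0: "0 \<le> y j" "(y j)\<^sup>2 = 1 + t j" "y j \<le> 2" if "j \<in> J" for j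
    using t[OF that] by (auto simp: y_def intro!: real_le_lsqrt)
  have t_s: "t j = 2 * s j + (s j)\<^sup>2" if "j \<in> J" for j
    using y0(2)[OF that] by (simp add: s_def power2_eq_square algebra_simps)
  \<comment> \<open>\<open>t = s (2 + s)\<close> with \<open>0 \<le> 2 + s = 1 + y \<le> 3\<close>, which is where the constant 9 comes from\<close>
  have s2: "(t j)\<^sup>2 / 9 \<le> (s j)\<^sup>2" if "j \<in> J" for j
  proof -
    have "(2 + s j)\<^sup>2 \<le> 3\<^sup>2" using y0[OF that] by (intro power_mono) (auto simp: s_def)
    then have "(s j)\<^sup>2 * (2 + s j)\<^sup>2 \<le> (s j)\<^sup>2 * 9" by (intro mult_left_mono) auto
    moreover have "(t j)\<^sup>2 = (s j)\<^sup>2 * (2 + s j)\<^sup>2"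
      unfolding t_s[OF that] power_mult_distrib[symmetric] by (simp add: power2_eq_square algebra_simps)
    ultimately show ?thesis by simp
  qed
  have W: "(\<Sum>j\<in>J. b j * y j) + (1 - q) = 1 + (\<Sum>j\<in>J. b j * s j)"
    by (simp add: s_def q_def algebra_simps sum_subtractf)
  have "weighted_prod J b (\<lambda>j. 1 + t j) = weighted_prod J b (\<lambda>j. y j * y j)"
    using y0(2) by (intro weighted_prod_cong) (auto simp: power2_eq_square)
  also have "\<dots> = (weighted_prod J b y)\<^sup>2"
    using y0 by (subst weighted_prod_mult) (auto simp: power2_eq_square)
  also have "\<dots> \<le> ((\<Sum>j\<in>J. b j * y j) + (1 - q))\<^sup>2"
    unfolding q_def by (intro power_mono weighted_am_gm weighted_prod_nonneg fin b sum y0)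
  also have "\<dots> = 1 + 2 * (\<Sum>j\<in>J. b j * s j) + (\<Sum>j\<in>J. b j * s j)\<^sup>2"
    unfolding W by (simp add: power2_eq_square algebra_simps)
  also have "\<dots> \<le> 1 + 2 * (\<Sum>j\<in>J. b j * s j) + q * (\<Sum>j\<in>J. b j * (s j)\<^sup>2)"
    using sum_weighted_square_le[of J b s, OF b] by (simp add: q_def)
  also have "\<dots> = 1 + (\<Sum>j\<in>J. b j * t j) - (1 - q) * (\<Sum>j\<in>J. b j * (s j)\<^sup>2)"
  proof -
    have "(\<Sum>j\<in>J. b j * t j) = (\<Sum>j\<in>J. 2 * (b j * s j) + b j * (s j)\<^sup>2)"
      using t_s by (intro sum.cong) (auto simp: algebra_simps)
    also have "\<dots> = 2 * (\<Sum>j\<in>J. b j * s j) + (\<Sum>j\<in>J. b j * (s j)\<^sup>2)"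
      by (simp add: sum.distrib sum_distrib_left[symmetric])
    finally show ?thesis by (simp add: algebra_simps)
  qed
  also have "\<dots> \<le> 1 + (\<Sum>j\<in>J. b j * t j) - (1 - q) * (\<Sum>j\<in>J. b j * ((t j)\<^sup>2 / 9))"
    using q b s2 by (intro diff_left_mono mult_left_mono sum_mono) auto
  finally show ?thesis by (simp add: q_def sum_divide_distrib[symmetric])
qed

text \<open>
  Weighted products are multiplicative, so both points may be rescaled coordinatewise to have midpoint
  \<open>(1, \<dots>, 1)\<close>; they become \<open>1 + t\<close> and \<open>1 - t\<close>.
\<close>

lemma weighted_prod_midpoint:
  fixes x y :: "'i \<Rightarrow> real"
  assumes fin: "finite J" and b: "\<And>j. j \<in> J \<Longrightarrow> 0 \<le> b j" and sum: "(\<Sum>j\<in>J. b j) \<le> 1"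
    and x: "\<And>j. j \<in> J \<Longrightarrow> 0 \<le> x j" and y: "\<And>j. j \<in> J \<Longrightarrow> 0 \<le> y j"
  defines "m \<equiv> weighted_prod J b (\<lambda>j. (x j + y j) / 2)"
    and "t \<equiv> \<lambda>j. (x j - y j) / (x j + y j)"
  shows "weighted_prod J b x
    \<le> m * (1 + (\<Sum>j\<in>J. b j * t j) - (1 - (\<Sum>j\<in>J. b j)) / 9 * (\<Sum>j\<in>J. b j * (t j)\<^sup>2))"
proof (cases "\<exists>j\<in>J. x j + y j = 0")
  case True
  then obtain j where j: "j \<in> J" "x j + y j = 0" by auto
  then have "x j = 0" using x[OF j(1)] y[OF j(1)] by simp
  then have "weighted_prod J b x = 0" "m = 0"
    using j fin by (auto simp: m_def intro!: weighted_prod_eq_0)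
  then show ?thesis by simp
next
  case False
  then have pos: "0 < x j + y j" if "j \<in> J" for j
    using x[OF that] y[OF that] that by (metis add_nonneg_nonneg order_le_less)
  have t1: "\<bar>t j\<bar> \<le> 1" if "j \<in> J" for j
    using pos[OF that] x[OF that] y[OF that] by (auto simp: t_def abs_le_iff field_simps)
  have "weighted_prod J b x = weighted_prod J b (\<lambda>j. (x j + y j) / 2 * (1 + t j))"
  proof (rule weighted_prod_cong)
    fix j assume "j \<in> J"
    then have "x j + y j \<noteq> 0" using pos by fastforce
    then have "(x j + y j) * (1 + t j) = 2 * x j"
      by (simp add: t_def distrib_left)
    then show "x j = (x j + y j) / 2 * (1 + t j)" by simp
  qed
  also have "\<dots> = m * weighted_prod J b (\<lambda>j. 1 + t j)"
    unfolding m_def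
  proof (rule weighted_prod_mult)
    fix j assume "j \<in> J"
    then show "0 \<le> (x j + y j) / 2" "0 \<le> 1 + t j" using pos t1 by (fastforce simp: abs_le_iff)+
  qed
  also have "\<dots> \<le> m * (1 + (\<Sum>j\<in>J. b j * t j)
      - (1 - (\<Sum>j\<in>J. b j)) / 9 * (\<Sum>j\<in>J. b j * (t j)\<^sup>2))"
    using t1 by (intro mult_left_mono weighted_prod_le_quadratic fin b sum)
      (auto simp: m_def weighted_prod_nonneg)
  finally show ?thesis .
qed

text \<open>
  The quantitative strict concavity that drives the whole proof. The quadratic remainder \<open>m V\<close>, with
  \<open>V = \<Sum>\<^sub>j b\<^sub>j t\<^sub>j\<^sup>2\<close>, is controlled by the concavity gap. What is needed later is linear in the
  relative differences \<open>t\<^sub>j\<close>; the free parameter \<open>d\<close> passes from squares to first powers through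
  \<open>\<bar>s\<bar> \<le> d + s\<^sup>2 / d\<close>, so that after integration it can be balanced against the size of the gap.
\<close>

lemma weighted_prod_gap:
  assumes fin: "finite J" and b: "\<And>j. j \<in> J \<Longrightarrow> 0 < b j" and sum: "(\<Sum>j\<in>J. b j) < 1"
  obtains C where "0 < C"
    "\<And>x y d m gap w. \<lbrakk>\<And>j. j \<in> J \<Longrightarrow> 0 \<le> x j; \<And>j. j \<in> J \<Longrightarrow> 0 \<le> y j; 0 < d; d \<le> 1;
        m = weighted_prod J b (\<lambda>j. (x j + y j) / 2);
        gap = m - (weighted_prod J b x + weighted_prod J b y) / 2;
        w = d * m + gap / d\<rbrakk> \<Longrightarrow>
      0 \<le> gap \<and> \<bar>weighted_prod J b x - weighted_prod J b y\<bar> \<le> C * w \<and>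
      (\<forall>j\<in>J. m * (\<bar>x j - y j\<bar> / (x j + y j)) \<le> C * w)"
proof
  define c where "c = (1 - (\<Sum>j\<in>J. b j)) / 9"
  define C where "C = 4 + 2 / c + (\<Sum>j\<in>J. 1 + 1 / (c * b j))"
  have c: "0 < c" using sum by (simp add: c_def)
  have Cs: "0 \<le> (\<Sum>j\<in>J. 1 + 1 / (c * b j))"
    using b c by (intro sum_nonneg) (simp add: less_imp_le)
  then show "0 < C" using c by (simp add: C_def add_pos_nonneg)
  fix x y :: "'a \<Rightarrow> real" and d m gap w :: real
  assume x: "\<And>j. j \<in> J \<Longrightarrow> 0 \<le> x j" and y: "\<And>j. j \<in> J \<Longrightarrow> 0 \<le> y j" and d: "0 < d" "d \<le> 1"
    and m_def: "m = weighted_prod J b (\<lambda>j. (x j + y j) / 2)"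
    and gap_def: "gap = m - (weighted_prod J b x + weighted_prod J b y) / 2"
    and w_def: "w = d * m + gap / d"
  define t where "t j = (x j - y j) / (x j + y j)" for j
  define \<tau> where "\<tau> = (\<Sum>j\<in>J. b j * t j)"
  define V where "V = (\<Sum>j\<in>J. b j * (t j)\<^sup>2)"
  have b': "\<And>j. j \<in> J \<Longrightarrow> 0 \<le> b j" using b by (simp add: less_imp_le)
  have m0: "0 \<le> m" by (simp add: m_def weighted_prod_nonneg)
  have V0: "0 \<le> V" unfolding V_def using b' by (intro sum_nonneg) auto
  have X: "weighted_prod J b x \<le> m * (1 + \<tau> - c * V)"
    using weighted_prod_midpoint[of J b x y, OF fin b' _ x y] sum by (simp add: m_def c_def V_def \<tau>_def t_def)
  have "(y j - x j) / (y j + x j) = - t j" for j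
    by (simp add: t_def add.commute minus_divide_left)
  then have Y: "weighted_prod J b y \<le> m * (1 - \<tau> - c * V)"
    using weighted_prod_midpoint[of J b y x, OF fin b' _ y x] sum
    by (simp add: m_def c_def V_def \<tau>_def sum_negf add.commute)
  have gapV: "c * (m * V) \<le> gap"
  proof -
    have "m * (1 + \<tau> - c * V) + m * (1 - \<tau> - c * V) = 2 * m - 2 * (c * (m * V))"
      by (simp add: algebra_simps)
    then have "weighted_prod J b x + weighted_prod J b y \<le> 2 * m - 2 * (c * (m * V))"
      using add_mono[OF X Y] by simp
    moreover have "z \<le> u - v / 2" if "v \<le> 2 * u - 2 * z" for u v z :: real
      using that by linarith
    ultimately show ?thesis unfolding gap_def by blast
  qed
  have gap0: "0 \<le> gap" using order_trans[OF _ gapV] c m0 V0 by simp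
  have gapd: "gap \<le> gap / d" using d gap0 by (simp add: field_simps mult_left_le mult_left_le_one_le)
  have dm: "0 \<le> d * m" using d m0 by simp
  have mV: "m * V / d \<le> 1 / c * (gap / d)"
    using gapV c d by (simp add: field_simps)
  have step: "m * \<bar>s\<bar> \<le> d * m + K * (m * V / d)" if "s\<^sup>2 \<le> K * V" for s K
  proof -
    have "2 * (\<bar>s\<bar> * d) \<le> s\<^sup>2 + d\<^sup>2" using sum_squares_bound[of "\<bar>s\<bar>" d] by simp
    then have "\<bar>s\<bar> * d \<le> K * V + d\<^sup>2" using that d mult_nonneg_nonneg[of "\<bar>s\<bar>" d] by linarith
    then have "m * (\<bar>s\<bar> * d) \<le> m * (K * V + d\<^sup>2)" using m0 by (rule mult_left_mono)
    then have "m * (\<bar>s\<bar> * d) / d \<le> m * (K * V + d\<^sup>2) / d" using d by (intro divide_right_mono) auto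
    also have "\<dots> = d * m + K * (m * V / d)"
      using d by (simp add: add_divide_distrib distrib_left power2_eq_square)
    finally show ?thesis using d by simp
  qed
  have tau: "m * \<bar>\<tau>\<bar> \<le> d * m + 1 * (m * V / d)"
  proof (rule step)
    have "\<tau>\<^sup>2 \<le> (\<Sum>j\<in>J. b j) * V" unfolding \<tau>_def V_def by (rule sum_weighted_square_le[OF b'])
    also have "\<dots> \<le> 1 * V" using V0 sum by (intro mult_right_mono) auto
    finally show "\<tau>\<^sup>2 \<le> 1 * V" .
  qed
  have diff: "\<bar>weighted_prod J b x - weighted_prod J b y\<bar> \<le> 2 * (m * \<bar>\<tau>\<bar>) + 2 * gap"
  proof -
    have *: "0 \<le> c * (m * V)" using c m0 V0 by simp
    have "weighted_prod J b x \<le> m + m * \<tau>" "weighted_prod J b y \<le> m - m * \<tau>"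
      using X Y * by (simp_all add: algebra_simps)
    moreover have "\<bar>m * \<tau>\<bar> = m * \<bar>\<tau>\<bar>" using m0 by (simp add: abs_mult)
    moreover have "\<bar>u - v\<bar> \<le> 2 * p + 2 * (n - (u + v) / 2)"
      if "u \<le> n + r" "v \<le> n - r" "\<bar>r\<bar> = p" for u v n r p :: real
      using that by (auto simp: abs_le_iff algebra_simps add_divide_distrib)
    ultimately show ?thesis unfolding gap_def by blast
  qed
  have C1: "\<bar>weighted_prod J b x - weighted_prod J b y\<bar> \<le> C * w"
  proof -
    have "\<bar>weighted_prod J b x - weighted_prod J b y\<bar> \<le> 2 * (d * m) + (2 / c) * (gap / d) + 2 * (gap / d)"
      using diff tau mV gapd by simp
    also have "\<dots> \<le> (4 + 2 / c) * (d * m) + (4 + 2 / c) * (gap / d)"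
    proof -
      have "2 * D + k * g + 2 * g \<le> (4 + k) * D + (4 + k) * g"
        if "0 \<le> k * D" "0 \<le> D" "0 \<le> g" for D g k :: real
        using that by (simp add: algebra_simps)
      moreover have "0 \<le> (2 / c) * (d * m)" "0 \<le> gap / d" using c d gap0 dm by simp_all
      ultimately show ?thesis using dm by blast
    qed
    also have "\<dots> = (4 + 2 / c) * w" by (simp add: w_def algebra_simps)
    also have "\<dots> \<le> C * w" using Cs dm gapd gap0 by (intro mult_right_mono) (auto simp: C_def w_def)
    finally show ?thesis .
  qed
  have C2: "m * (\<bar>x j - y j\<bar> / (x j + y j)) \<le> C * w" if j: "j \<in> J" for j
  proof -
    have "b j * (t j)\<^sup>2 \<le> V" unfolding V_def using fin b' j by (intro member_le_sum) auto
    then have "(t j)\<^sup>2 \<le> 1 / b j * V" using b[OF j] by (simp add: field_simps)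
    note step[OF this]
    also have "d * m + 1 / b j * (m * V / d) \<le> d * m + 1 / b j * (1 / c * (gap / d))"
      by (intro add_left_mono mult_left_mono mV) (simp add: b'[OF j])
    also have "\<dots> \<le> (1 + 1 / (c * b j)) * w"
    proof -
      have "D + k * g \<le> (1 + k) * (D + g)"
        if "0 \<le> k * D" "0 \<le> g" for D g k :: real
        using that by (simp add: algebra_simps)
      moreover have "0 \<le> 1 / (c * b j) * (d * m)" "0 \<le> gap / d"
        using c b'[OF j] dm d gap0 by simp_all
      moreover have "1 / b j * (1 / c * (gap / d)) = 1 / (c * b j) * (gap / d)" by simp
      ultimately show ?thesis unfolding w_def by metis
    qed
    also have "\<dots> \<le> C * w"
    proof (rule mult_right_mono)
      have "1 + 1 / (c * b j) \<le> (\<Sum>j\<in>J. 1 + 1 / (c * b j))"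
        using fin b' j c by (intro member_le_sum) auto
      then show "1 + 1 / (c * b j) \<le> C" using c by (simp add: C_def add_nonneg_nonneg add.commute add_increasing)
      show "0 \<le> w" using dm gapd gap0 by (simp add: w_def)
    qed
    finally show ?thesis using x[OF j] y[OF j] by (simp add: t_def abs_divide)
  qed
  show "0 \<le> gap \<and> \<bar>weighted_prod J b x - weighted_prod J b y\<bar> \<le> C * w \<and>
      (\<forall>j\<in>J. m * (\<bar>x j - y j\<bar> / (x j + y j)) \<le> C * w)"
    using gap0 C1 C2 by blast
qed

text \<open>Relative steps are comparable to the increments of \<open>ln y\<close>, so \<open>ln y\<close> converges.\<close>

lemma convergent_of_summable_relative_steps:
  fixes y :: "nat \<Rightarrow> real"
  assumes pos: "eventually (\<lambda>n. 0 < y n) sequentially"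
    and summ: "summable (\<lambda>n. \<bar>y n - y (Suc n)\<bar> / (y n + y (Suc n)))"
  shows "\<exists>L>0. y \<longlonglongrightarrow> L"
proof -
  define t where "t n = \<bar>y n - y (Suc n)\<bar> / (y n + y (Suc n))" for n
  have "t \<longlonglongrightarrow> 0" using summ unfolding t_def by (rule summable_LIMSEQ_zero)
  then have "eventually (\<lambda>n. t n < 1/2) sequentially" by (rule order_tendstoD) simp
  moreover have "eventually (\<lambda>n. 0 < y (Suc n)) sequentially"
    using pos by (rule eventually_sequentially_Suc[THEN iffD2])
  ultimately have "eventually (\<lambda>n. norm (ln (y (Suc n)) - ln (y n)) \<le> 4 * t n) sequentially"
    using pos
  proof eventually_elim
    case (elim n)
    have key: "ln u - ln v \<le> 4 * (\<bar>u - v\<bar> / (u + v))"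
      if "0 < u" "0 < v" "\<bar>u - v\<bar> / (u + v) < 1/2" for u v :: real
    proof -
      have 1: "2 * \<bar>u - v\<bar> < u + v" using that by (simp add: field_simps)
      have "ln u - ln v = ln (u / v)" using that by (simp add: ln_div)
      also have "\<dots> \<le> u / v - 1" using that by (intro ln_le_minus_one) auto
      also have "\<dots> = (u - v) / v" using that by (simp add: field_simps)
      also have "\<dots> \<le> \<bar>u - v\<bar> / v" using that by (intro divide_right_mono) auto
      also have "\<dots> \<le> \<bar>u - v\<bar> / ((u + v) / 4)" using that 1 by (intro divide_left_mono) (auto simp: abs_if split: if_splits)
      finally show ?thesis by (simp add: mult.commute)
    qed
    have "ln (y (Suc n)) - ln (y n) \<le> 4 * t n" "ln (y n) - ln (y (Suc n)) \<le> 4 * t n"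
      using key[of "y (Suc n)" "y n"] key[of "y n" "y (Suc n)"] elim
      by (auto simp: t_def abs_minus_commute add.commute)
    then show ?case by auto
  qed
  then have "summable (\<lambda>n. ln (y (Suc n)) - ln (y n))"
    by (rule summable_comparison_test_ev[OF _ summable_mult]) (use summ in \<open>simp add: t_def\<close>)
  then have "convergent (\<lambda>n. \<Sum>k<n. ln (y (Suc k)) - ln (y k))"
    by (simp add: summable_iff_convergent)
  then obtain l where "(\<lambda>n. ln (y n) - ln (y 0)) \<longlonglongrightarrow> l"
    unfolding sum_lessThan_telescope[of "\<lambda>k. ln (y k)"] convergent_def by blast
  from tendsto_add[OF this tendsto_const[of "ln (y 0)"]]
  have "(\<lambda>n. ln (y n)) \<longlonglongrightarrow> l + ln (y 0)" by simp
  then have "(\<lambda>n. exp (ln (y n))) \<longlonglongrightarrow> exp (l + ln (y 0))" by (rule tendsto_exp)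
  moreover have "eventually (\<lambda>n. exp (ln (y n)) = y n) sequentially"
    using pos by eventually_elim simp
  ultimately have "y \<longlonglongrightarrow> exp (l + ln (y 0))" by (rule Lim_transform_eventually)
  then show ?thesis using exp_gt_zero by blast
qed

section \<open>Maximising the integral of a weighted product over a convex set\<close>

lemma AE_summable_of_geometric_integrals:
  fixes M :: "'a measure" and w :: "nat \<Rightarrow> 'a \<Rightarrow> real"
  assumes int: "\<And>n. integrable M (w n)" and nn: "\<And>n x. 0 \<le> w n x"
    and le: "\<And>n. (\<integral>x. w n x \<partial>M) \<le> (1/2) ^ n * B"
  shows "AE x in M. summable (\<lambda>n. w n x)" and "integrable M (\<lambda>x. \<Sum>n. w n x)"
proof -
  have summ: "summable (\<lambda>n. \<integral>x. w n x \<partial>M)"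
  proof (rule summable_comparison_test'[where N=0])
    show "summable (\<lambda>n. (1/2) ^ n * B)" by (intro summable_mult2 summable_geometric) simp
    show "norm (\<integral>x. w n x \<partial>M) \<le> (1/2) ^ n * B" for n
      using le[of n] nn by (simp add: integral_nonneg_AE)
  qed
  have [measurable]: "w n \<in> borel_measurable M" for n using int by blast
  have "(\<integral>\<^sup>+x. (\<Sum>n. ennreal (w n x)) \<partial>M) = (\<Sum>n. \<integral>\<^sup>+x. ennreal (w n x) \<partial>M)"
    by (rule nn_integral_suminf) measurable
  also have "\<dots> = (\<Sum>n. ennreal (\<integral>x. w n x \<partial>M))"
    using nn by (intro suminf_cong nn_integral_eq_integral int) auto
  also have "\<dots> \<noteq> \<infinity>"
    using nn summ by (subst suminf_ennreal2) (auto intro: integral_nonneg_AE)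
  finally have "AE x in M. (\<Sum>n. ennreal (w n x)) \<noteq> \<infinity>"
    by (intro nn_integral_PInf_AE) measurable
  then show *: "AE x in M. summable (\<lambda>n. w n x)"
    by eventually_elim (auto intro!: summable_suminf_not_top nn)
  show "integrable M (\<lambda>x. \<Sum>n. w n x)"
    using * summ nn by (intro integrable_suminf int) auto
qed

text \<open>
  The abstract form of the maximisation problem. Saturation says that on a part of
  positive measure of any given set of positive measure some member of \<open>K\<close> has only positive components. The supremum of the integral need not be attained in \<open>K\<close>.
\<close>

locale bounded_convex_family =
  fixes M :: "'a measure" and J :: "'i set" and b :: "'i \<Rightarrow> real" and K :: "('i \<Rightarrow> 'a \<Rightarrow> real) set"
  assumes finite_J: "finite J"
    and b_pos: "j \<in> J \<Longrightarrow> 0 < b j"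
    and sum_b: "(\<Sum>j\<in>J. b j) < 1"
    and sum_b_pos: "0 < (\<Sum>j\<in>J. b j)"
    and measurable_K: "u \<in> K \<Longrightarrow> j \<in> J \<Longrightarrow> u j \<in> borel_measurable M"
    and nonneg_K: "u \<in> K \<Longrightarrow> j \<in> J \<Longrightarrow> 0 \<le> u j x"
    and convex_K: "\<lbrakk>u \<in> K; v \<in> K; 0 < s; 0 < t; s + t = 1\<rbrakk> \<Longrightarrow> (\<lambda>j x. s * u j x + t * v j x) \<in> K"
    and bounded_K: "\<exists>B. \<forall>u\<in>K. (\<integral>\<^sup>+x. ennreal (weighted_prod J b (\<lambda>j. u j x)) \<partial>M) \<le> ennreal B"
    and saturated_K: "\<lbrakk>E \<in> sets M; 0 < emeasure M E\<rbrakk> \<Longrightarrow>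
      \<exists>u\<in>K. \<exists>E'\<in>sets M. E' \<subseteq> E \<and> 0 < emeasure M E' \<and> (AE x in M. x \<in> E' \<longrightarrow> (\<forall>j\<in>J. 0 < u j x))"
    and nontrivial_M: "emeasure M (space M) \<noteq> 0"
begin

definition q :: real where "q = (\<Sum>j\<in>J. b j)"

definition gm :: "('i \<Rightarrow> 'a \<Rightarrow> real) \<Rightarrow> 'a \<Rightarrow> real" where
  "gm u x = weighted_prod J b (\<lambda>j. u j x)"

definition S :: real where "S = (SUP u\<in>K. \<integral>x. gm u x \<partial>M)"

lemma q: "0 < q" "q < 1"
  using sum_b sum_b_pos by (auto simp: q_def)

lemma b_nonneg: "j \<in> J \<Longrightarrow> 0 \<le> b j"
  using b_pos by (simp add: less_imp_le)

lemma gm_nonneg: "0 \<le> gm u x"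
  by (simp add: gm_def weighted_prod_nonneg)

lemma measurable_gm: "(\<And>j. j \<in> J \<Longrightarrow> u j \<in> borel_measurable M) \<Longrightarrow> gm u \<in> borel_measurable M"
  unfolding gm_def weighted_prod_def by (intro borel_measurable_prod powr_real_measurable) auto

lemma measurable_gm_K: "u \<in> K \<Longrightarrow> gm u \<in> borel_measurable M"
  by (intro measurable_gm measurable_K)

lemma integrable_gm: "u \<in> K \<Longrightarrow> integrable M (gm u)"
  using bounded_K
  by (intro integrableI_nonneg measurable_gm_K) (auto simp: gm_nonneg gm_def weighted_prod_nonneg intro: le_less_trans)

lemma bdd_above_K: "bdd_above ((\<lambda>u. \<integral>x. gm u x \<partial>M) ` K)"
proof -
  obtain B where B: "\<And>u. u \<in> K \<Longrightarrow> (\<integral>\<^sup>+x. ennreal (gm u x) \<partial>M) \<le> ennreal B"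
    using bounded_K unfolding gm_def by blast
  show ?thesis
  proof (rule bdd_aboveI2)
    fix u assume u: "u \<in> K"
    have "ennreal (\<integral>x. gm u x \<partial>M) \<le> ennreal B"
      using B[OF u] nn_integral_eq_integral[OF integrable_gm[OF u]] gm_nonneg by auto
    then show "(\<integral>x. gm u x \<partial>M) \<le> max 0 B"
      using ennreal_le_iff2 by (metis max.coboundedI1 max.coboundedI2)
  qed
qed

lemma integral_gm_le: "u \<in> K \<Longrightarrow> (\<integral>x. gm u x \<partial>M) \<le> S"
  unfolding S_def by (rule cSUP_upper[OF _ bdd_above_K])

lemma nonempty_K: "K \<noteq> {}"
  using saturated_K[of "space M"] nontrivial_M by (auto simp: zero_less_iff_neq_zero)

lemma S_nonneg: "0 \<le> S"
proof -
  obtain u where u: "u \<in> K" using nonempty_K by blast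
  have "0 \<le> (\<integral>x. gm u x \<partial>M)" by (simp add: gm_nonneg)
  then show ?thesis using integral_gm_le[OF u] by simp
qed

lemma gm_mono:
  assumes "\<And>j. j \<in> J \<Longrightarrow> 0 \<le> u j x" "\<And>j. j \<in> J \<Longrightarrow> u j x \<le> v j x"
  shows "gm u x \<le> gm v x"
  unfolding gm_def using assms b_nonneg by (intro weighted_prod_mono) auto

lemma gm_scale:
  assumes "0 < s" "\<And>j. j \<in> J \<Longrightarrow> 0 \<le> u j x"
  shows "gm (\<lambda>j x. s * u j x) x = s powr q * gm u x"
  unfolding gm_def q_def using assms finite_J by (intro weighted_prod_scale) auto

lemma one_plus_powr_q_le:
  assumes "0 \<le> t"
  shows "(1 + t) powr q \<le> 1 + q * t"
  using weighted_am_gm[of "{()}" "\<lambda>_. q" "\<lambda>_. 1 + t"] assms q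
  by (simp add: weighted_prod_def algebra_simps)

text \<open>
  Up to the factor \<open>1 + t\<close>, the perturbed tuple is a convex combination of \<open>u\<close> and \<open>v\<close>. Perturbing
  by addition, and not along the segment from \<open>u\<close> to \<open>v\<close>, keeps the change of the integrand nonnegative,
  which Fatou's lemma needs below.
\<close>

lemma integral_gm_perturbed_le:
  assumes u: "u \<in> K" and v: "v \<in> K" and t: "0 < t"
  shows "integrable M (gm (\<lambda>j x. u j x + t * v j x))"
    and "(\<integral>x. gm (\<lambda>j x. u j x + t * v j x) x \<partial>M) \<le> (1 + q * t) * S"
proof -
  define w where "w j x = (1 / (1 + t)) * u j x + (t / (1 + t)) * v j x" for j x
  have w: "w \<in> K"
    unfolding w_def using t by (intro convex_K u v) (auto simp: field_simps)
  have eq: "gm (\<lambda>j x. u j x + t * v j x) = (\<lambda>x. (1 + t) powr q * gm w x)"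
  proof
    fix x
    have "u j x + t * v j x = (1 + t) * w j x" for j
      using t by (simp add: w_def distrib_left)
    then show "gm (\<lambda>j x. u j x + t * v j x) x = (1 + t) powr q * gm w x"
      using gm_scale[of "1 + t" w x] t nonneg_K[OF w] by (simp add: gm_def)
  qed
  show "integrable M (gm (\<lambda>j x. u j x + t * v j x))"
    unfolding eq using integrable_gm[OF w] by simp
  have "(\<integral>x. gm (\<lambda>j x. u j x + t * v j x) x \<partial>M) = (1 + t) powr q * (\<integral>x. gm w x \<partial>M)"
    unfolding eq by simp
  also have "\<dots> \<le> (1 + q * t) * S"
    using t one_plus_powr_q_le[of t] integral_gm_le[OF w] q
    by (intro mult_mono) (auto simp: gm_nonneg)
  finally show "(\<integral>x. gm (\<lambda>j x. u j x + t * v j x) x \<partial>M) \<le> (1 + q * t) * S" .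
qed

lemma maximizing_sequence:
  obtains U where "\<And>n. U n \<in> K" "\<And>n. S - (1/4) ^ n \<le> (\<integral>x. gm (U n) x \<partial>M)"
proof -
  have "\<exists>u\<in>K. S - (1/4) ^ n \<le> (\<integral>x. gm u x \<partial>M)" for n :: nat
  proof -
    have "S - (1/4) ^ n < (SUP u\<in>K. \<integral>x. gm u x \<partial>M)" unfolding S_def[symmetric] by simp
    then show ?thesis
      using less_cSUP_iff[OF nonempty_K bdd_above_K] by (auto intro: less_imp_le)
  qed
  then show thesis using that by metis
qed

text \<open>
  Consecutive members of a maximising sequence are compared through \<open>weighted_prod_gap\<close>. Their midpoint
  belongs to \<open>K\<close>, so the integral of the gap is at most the defect \<open>(1/4) ^ n\<close> from the supremum; with
  \<open>d = (1/2) ^ n\<close> the error term \<open>w n\<close> has integral of order \<open>(1/2) ^ n\<close>. Hence \<open>\<Sum>n. w n x\<close> is finite almost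
  everywhere and integrable. It makes \<open>gm (U n) x\<close> Cauchy and dominated, and where the
  limit \<open>F x\<close> is positive it makes the relative steps of each coordinate summable. Where \<open>F\<close> vanishes
  nothing is claimed about the coordinates.
\<close>

lemma maximizing_sequence_converges:
  obtains U F where "\<And>n. U n \<in> K" "(\<lambda>n. \<integral>x. gm (U n) x \<partial>M) \<longlonglongrightarrow> S"
    "integrable M F" "\<And>x. 0 \<le> F x" "(\<integral>x. F x \<partial>M) = S"
    "(\<lambda>n. \<integral>x. \<bar>gm (U n) x - F x\<bar> \<partial>M) \<longlonglongrightarrow> 0"
    "AE x in M. 0 < F x \<longrightarrow> (\<forall>j\<in>J. \<exists>L>0. (\<lambda>n. U n j x) \<longlonglongrightarrow> L)"
    "AE x in M. (\<lambda>n. gm (U n) x) \<longlonglongrightarrow> F x"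
proof -
  obtain U where U: "\<And>n. U n \<in> K" and Umax: "\<And>n. S - (1/4) ^ n \<le> (\<integral>x. gm (U n) x \<partial>M)"
    using maximizing_sequence by blast
  obtain C where C: "0 < C" and gap_est:
    "\<And>x y d m gap w. \<lbrakk>\<And>j. j \<in> J \<Longrightarrow> 0 \<le> x j; \<And>j. j \<in> J \<Longrightarrow> 0 \<le> y j; 0 < d; d \<le> 1;
        m = weighted_prod J b (\<lambda>j. (x j + y j) / 2);
        gap = m - (weighted_prod J b x + weighted_prod J b y) / 2;
        w = d * m + gap / d\<rbrakk> \<Longrightarrow>
      0 \<le> gap \<and> \<bar>weighted_prod J b x - weighted_prod J b y\<bar> \<le> C * w \<and>
      (\<forall>j\<in>J. m * (\<bar>x j - y j\<bar> / (x j + y j)) \<le> C * w)"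
    using weighted_prod_gap[of J b, OF finite_J b_pos sum_b] by blast
  define G where "G n = gm (U n)" for n
  define m where "m n = gm (\<lambda>j x. (U n j x + U (Suc n) j x) / 2)" for n
  define gap where "gap n x = m n x - (G n x + G (Suc n) x) / 2" for n x
  define w where "w n x = (1/2) ^ n * m n x + gap n x / (1/2) ^ n" for n x
  have est: "0 \<le> gap n x" "\<bar>G n x - G (Suc n) x\<bar> \<le> C * w n x"
    "j \<in> J \<Longrightarrow> m n x * (\<bar>U n j x - U (Suc n) j x\<bar> / (U n j x + U (Suc n) j x)) \<le> C * w n x"
    for n x j
    using gap_est[of "\<lambda>j. U n j x" "\<lambda>j. U (Suc n) j x" "(1/2) ^ n" "m n x" "gap n x" "w n x"]
      nonneg_K[OF U]
    by (auto simp: m_def gap_def w_def G_def gm_def power_le_one)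
  have m0: "0 \<le> m n x" "0 \<le> G n x" for n x by (auto simp: m_def G_def gm_nonneg)
  have mid: "(\<lambda>j x. (U n j x + U (Suc n) j x) / 2) \<in> K" for n
    using convex_K[OF U U, of "1/2" "1/2" n "Suc n"] by (simp add: add_divide_distrib)
  have G_int: "integrable M (G n)" for n unfolding G_def by (rule integrable_gm[OF U])
  have m_int: "integrable M (m n)" for n unfolding m_def by (rule integrable_gm[OF mid])
  have gap_int: "integrable M (gap n)" for n
    unfolding gap_def using G_int m_int by simp
  have w_int: "integrable M (w n)" for n
    unfolding w_def using gap_int m_int by simp
  have w0: "0 \<le> w n x" for n x using est(1) m0 by (simp add: w_def)
  have w_le: "(\<integral>x. w n x \<partial>M) \<le> (1/2) ^ n * (S + 1)" for n
  proof -
    have pw: "(1/4 :: real) ^ n = (1/2) ^ n * (1/2) ^ n"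
      by (simp flip: power_mult_distrib)
    have mS: "(\<integral>x. m n x \<partial>M) \<le> S" unfolding m_def by (rule integral_gm_le[OF mid])
    have "(\<integral>x. gap n x \<partial>M) = (\<integral>x. m n x \<partial>M) - ((\<integral>x. G n x \<partial>M) + (\<integral>x. G (Suc n) x \<partial>M)) / 2"
      unfolding gap_def using G_int m_int by simp
    also have "\<dots> \<le> (1/4) ^ n"
    proof -
      have "a - (g + h) / 2 \<le> e" if "a \<le> S" "S - e \<le> g" "S - e / 4 \<le> h" "0 \<le> e" for a g h e :: real
        using that by (simp add: field_simps)
      from this[OF mS Umax[of n]] Umax[of "Suc n"] show ?thesis by (simp add: G_def)
    qed
    finally have gap_le: "(\<integral>x. gap n x \<partial>M) / (1/2) ^ n \<le> (1/2) ^ n"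
      using pw by (simp add: field_simps)
    have "(\<integral>x. w n x \<partial>M) = (1/2) ^ n * (\<integral>x. m n x \<partial>M) + (\<integral>x. gap n x \<partial>M) / (1/2) ^ n"
      unfolding w_def using gap_int m_int by simp
    also have "\<dots> \<le> (1/2) ^ n * S + (1/2) ^ n"
      using gap_le mS by (intro add_mono mult_left_mono) auto
    finally show ?thesis by (simp add: distrib_left)
  qed
  note w_summ = AE_summable_of_geometric_integrals[OF w_int w0 w_le]
  \<comment> \<open>the limit is nonnegative wherever it exists; the maximum makes \<open>F\<close> nonnegative everywhere\<close>
  define F where "F x = max 0 (lim (\<lambda>n. G n x))" for x
  define W where "W x = G 0 x + C * (\<Sum>n. w n x)" for x
  have W_int: "integrable M W" unfolding W_def using G_int w_summ(2) by simp
  have conv: "(\<lambda>n. G n x) \<longlonglongrightarrow> F x" and dom: "G n x \<le> W x"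
    if summ: "summable (\<lambda>n. w n x)" for x n
  proof -
    have Cw: "summable (\<lambda>n. C * w n x)" using summ by (rule summable_mult)
    have "summable (\<lambda>n. G (Suc n) x - G n x)"
      by (rule summable_comparison_test'[OF Cw]) (use est(2) in \<open>auto simp: abs_minus_commute\<close>)
    then have "convergent (\<lambda>n. \<Sum>k<n. G (Suc k) x - G k x)"
      by (simp add: summable_iff_convergent)
    then obtain l where "(\<lambda>n. G n x - G 0 x) \<longlonglongrightarrow> l"
      unfolding sum_lessThan_telescope[of "\<lambda>k. G k x"] convergent_def by blast
    from tendsto_add[OF this tendsto_const[of "G 0 x"]]
    have l: "(\<lambda>n. G n x) \<longlonglongrightarrow> l + G 0 x" by simp
    moreover have "0 \<le> l + G 0 x" using l m0 by (intro LIMSEQ_le_const[OF l]) auto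
    ultimately show "(\<lambda>n. G n x) \<longlonglongrightarrow> F x" by (simp add: F_def limI)
    have "G n x - G 0 x = (\<Sum>k<n. G (Suc k) x - G k x)"
      by (rule sum_lessThan_telescope[of "\<lambda>k. G k x", symmetric])
    also have "\<dots> \<le> (\<Sum>k<n. C * w k x)"
      using est(2) by (intro sum_mono) (smt (verit))
    also have "\<dots> \<le> (\<Sum>k. C * w k x)"
      using Cw C w0 by (intro sum_le_suminf) auto
    also have "\<dots> = C * (\<Sum>k. w k x)" using summ by (rule suminf_mult)
    finally show "G n x \<le> W x" by (simp add: W_def)
  qed
  have AE_conv: "AE x in M. (\<lambda>n. G n x) \<longlonglongrightarrow> F x"
    using w_summ(1) by eventually_elim (rule conv)
  have AE_dom: "AE x in M. norm (G n x) \<le> W x" for n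
    using w_summ(1) by eventually_elim (use dom m0 in auto)
  have G_meas[measurable]: "G n \<in> borel_measurable M" for n using G_int by blast
  have F_meas[measurable]: "F \<in> borel_measurable M" unfolding F_def by measurable
  have F_int: "integrable M F"
    by (rule integrable_dominated_convergence[OF F_meas G_meas W_int AE_conv AE_dom])
  have G_lim: "(\<lambda>n. \<integral>x. G n x \<partial>M) \<longlonglongrightarrow> (\<integral>x. F x \<partial>M)"
    by (rule integral_dominated_convergence[OF F_meas G_meas W_int AE_conv AE_dom])
  have G_limS: "(\<lambda>n. \<integral>x. G n x \<partial>M) \<longlonglongrightarrow> S"
  proof (rule tendsto_sandwich)
    show "eventually (\<lambda>n. S - (1/4) ^ n \<le> (\<integral>x. G n x \<partial>M)) sequentially"
      using Umax by (simp add: G_def)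
    show "eventually (\<lambda>n. (\<integral>x. G n x \<partial>M) \<le> S) sequentially"
      using integral_gm_le[OF U] by (simp add: G_def)
    show "(\<lambda>n. S - (1/4) ^ n) \<longlonglongrightarrow> S"
      using tendsto_diff[OF tendsto_const[of S] LIMSEQ_power_zero[of "1/4::real"]] by simp
  qed simp
  have L1: "(\<lambda>n. \<integral>x. \<bar>G n x - F x\<bar> \<partial>M) \<longlonglongrightarrow> (\<integral>x. 0 \<partial>M)"
  proof (rule integral_dominated_convergence)
    show "integrable M (\<lambda>x. W x + F x)" using W_int F_int by simp
    show "AE x in M. (\<lambda>n. \<bar>G n x - F x\<bar>) \<longlonglongrightarrow> 0"
      using AE_conv by eventually_elim (simp add: LIM_zero tendsto_rabs_zero)
    show "AE x in M. norm \<bar>G n x - F x\<bar> \<le> W x + F x" for n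
      using AE_dom[of n]
    proof eventually_elim
      case (elim x)
      have "0 \<le> F x" by (simp add: F_def)
      then show ?case using elim m0(2)[of n x] by simp
    qed
  qed measurable
  have coord: "\<exists>L>0. (\<lambda>n. U n j x) \<longlonglongrightarrow> L"
    if summ: "summable (\<lambda>n. w n x)" and F: "0 < F x" and j: "j \<in> J" for x j
  proof (rule convergent_of_summable_relative_steps)
    have ev: "eventually (\<lambda>n. F x / 2 < G n x) sequentially"
      using order_tendstoD(1)[OF conv[OF summ], of "F x / 2"] F by simp
    then show "eventually (\<lambda>n. 0 < U n j x) sequentially"
    proof eventually_elim
      case (elim n)
      then have "G n x \<noteq> 0" using F by auto
      then have "U n j x \<noteq> 0" unfolding G_def gm_def using weighted_prod_eq_0[OF finite_J j] by metis
      then show ?case using nonneg_K[OF U j, of n x] by simp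
    qed
    have "eventually (\<lambda>n. F x / 2 < G (Suc n) x) sequentially"
      using ev by (rule eventually_sequentially_Suc[THEN iffD2])
    with ev have "eventually (\<lambda>n. norm (\<bar>U n j x - U (Suc n) j x\<bar> / (U n j x + U (Suc n) j x))
        \<le> 2 / F x * (C * w n x)) sequentially"
    proof eventually_elim
      case (elim n)
      define t where "t = \<bar>U n j x - U (Suc n) j x\<bar> / (U n j x + U (Suc n) j x)"
      have t0: "0 \<le> t" using nonneg_K[OF U j] by (simp add: t_def)
      have "F x / 2 \<le> m n x" using elim est(1)[of n x] unfolding gap_def by argo
      then have "F x / 2 * t \<le> m n x * t" using t0 by (rule mult_right_mono)
      also have "\<dots> \<le> C * w n x" using est(3)[OF j] by (simp add: t_def)
      finally show ?case using F t0 unfolding t_def[symmetric] by (simp add: field_simps)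
    qed
    moreover have "summable (\<lambda>n. 2 / F x * (C * w n x))"
      by (intro summable_mult summ)
    ultimately show "summable (\<lambda>n. \<bar>U n j x - U (Suc n) j x\<bar> / (U n j x + U (Suc n) j x))"
      by (rule summable_comparison_test_ev)
  qed
  show thesis
  proof (rule that[of U F])
    show "AE x in M. 0 < F x \<longrightarrow> (\<forall>j\<in>J. \<exists>L>0. (\<lambda>n. U n j x) \<longlonglongrightarrow> L)"
      using w_summ(1) by eventually_elim (use coord in blast)
    show "(\<integral>x. F x \<partial>M) = S" using LIMSEQ_unique[OF G_lim G_limS] .
    show "0 \<le> F x" for x by (simp add: F_def)
  qed (use U G_limS F_int L1 AE_conv in \<open>simp_all add: G_def\<close>)
qed

text \<open>
  If \<open>F\<close> vanished on a set \<open>Z\<close> of positive measure, some \<open>v \<in> K\<close> would be positive on a part \<open>E\<close> of it.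
  Adding \<open>t v\<close> to \<open>U n\<close> increases the integral by at least \<open>t powr q * \<delta>\<close> in the limit, because the product
  is homogeneous of degree \<open>q\<close>, and by at most \<open>q * t * S\<close>. As \<open>q < 1\<close>, this is impossible for small \<open>t\<close>.
\<close>

lemma limit_positive:
  assumes U: "\<And>n. U n \<in> K" and U_lim: "(\<lambda>n. \<integral>x. gm (U n) x \<partial>M) \<longlonglongrightarrow> S"
    and F_int: "integrable M F" and F0: "\<And>x. 0 \<le> F x"
    and L1: "(\<lambda>n. \<integral>x. \<bar>gm (U n) x - F x\<bar> \<partial>M) \<longlonglongrightarrow> 0"
  shows "AE x in M. 0 < F x"
proof (rule ccontr)
  assume not: "\<not> (AE x in M. 0 < F x)"
  have [measurable]: "F \<in> borel_measurable M" using F_int by blast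
  define Z where "Z = {x \<in> space M. \<not> 0 < F x}"
  have Z: "Z \<in> sets M" unfolding Z_def by measurable
  have "emeasure M Z \<noteq> 0" using not AE_iff_measurable[OF Z, of "\<lambda>x. 0 < F x"] by (auto simp: Z_def)
  then obtain v E where v: "v \<in> K" and E[measurable]: "E \<in> sets M" and "E \<subseteq> Z" and E_pos: "0 < emeasure M E"
    and v_pos: "AE x in M. x \<in> E \<longrightarrow> (\<forall>j\<in>J. 0 < v j x)"
    using saturated_K[OF Z] by (auto simp: zero_less_iff_neq_zero)
  define \<delta> where "\<delta> = (\<integral>x. indicator E x * gm v x \<partial>M)"
  have v_int: "integrable M (\<lambda>x. indicator E x * gm v x)"
    using integrable_mult_indicator[OF E integrable_gm[OF v]] by simp
  have \<delta>: "0 < \<delta>"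
  proof -
    have "\<delta> \<noteq> 0"
    proof
      assume "\<delta> = 0"
      then have "AE x in M. indicator E x * gm v x = 0"
        unfolding \<delta>_def using integral_nonneg_eq_0_iff_AE[OF v_int] by (simp add: gm_nonneg)
      then have "AE x in M. x \<notin> E" using v_pos
      proof eventually_elim
        case (elim x)
        show ?case
        proof
          assume x: "x \<in> E"
          then have "0 < gm v x" unfolding gm_def using elim(2) by (intro weighted_prod_pos) auto
          then show False using elim(1) x by simp
        qed
      qed
      moreover have "{x \<in> space M. \<not> x \<notin> E} = E" using sets.sets_into_space[OF E] by auto
      ultimately show False using E_pos AE_iff_measurable[OF E, of "\<lambda>x. x \<notin> E"] by auto
    qed
    moreover have "0 \<le> \<delta>" unfolding \<delta>_def by (simp add: gm_nonneg)
    ultimately show ?thesis by simp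
  qed
  have key: "t powr q * \<delta> \<le> q * t * S" if t: "0 < t" for t
  proof -
    \<comment> \<open>on \<open>E\<close> the subtracted term cancels \<open>gm (U n)\<close>, since \<open>F\<close> vanishes there\<close>
    have bound: "(\<integral>x. gm (U n) x \<partial>M) + t powr q * \<delta> - (\<integral>x. \<bar>gm (U n) x - F x\<bar> \<partial>M) \<le> (1 + q * t) * S" for n
    proof -
      have int: "integrable M (gm (U n))" "integrable M (\<lambda>x. \<bar>gm (U n) x - F x\<bar>)"
        using integrable_gm[OF U] F_int by auto
      have "(\<integral>x. gm (U n) x \<partial>M) + t powr q * \<delta> - (\<integral>x. \<bar>gm (U n) x - F x\<bar> \<partial>M)
          = (\<integral>x. gm (U n) x + t powr q * (indicator E x * gm v x) - \<bar>gm (U n) x - F x\<bar> \<partial>M)"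
        unfolding \<delta>_def using int v_int by simp
      also have "\<dots> \<le> (\<integral>x. gm (\<lambda>j x. U n j x + t * v j x) x \<partial>M)"
      proof (rule integral_mono)
        show "integrable M (\<lambda>x. gm (U n) x + t powr q * (indicator E x * gm v x) - \<bar>gm (U n) x - F x\<bar>)"
          using int v_int by simp
        show "integrable M (gm (\<lambda>j x. U n j x + t * v j x))"
          by (rule integral_gm_perturbed_le(1)[OF U v t])
        fix x
        have U0: "0 \<le> U n j x" and tv0: "0 \<le> t * v j x" if "j \<in> J" for j
          using nonneg_K[OF U that] nonneg_K[OF v that, of x] t by auto
        show "gm (U n) x + t powr q * (indicator E x * gm v x) - \<bar>gm (U n) x - F x\<bar>
            \<le> gm (\<lambda>j x. U n j x + t * v j x) x"
        proof (cases "x \<in> E")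
          case True
          then have "F x = 0" using \<open>E \<subseteq> Z\<close> F0[of x] by (auto simp: Z_def)
          moreover have "t powr q * gm v x \<le> gm (\<lambda>j x. U n j x + t * v j x) x"
            using gm_mono[of "\<lambda>j x. t * v j x" x "\<lambda>j x. U n j x + t * v j x"] U0 tv0
              gm_scale[of t v x] t nonneg_K[OF v] by simp
          ultimately show ?thesis using True gm_nonneg[of "U n" x] by simp
        next
          case False
          then show ?thesis
            using gm_mono[of "U n" x "\<lambda>j x. U n j x + t * v j x"] U0 tv0 by simp
        qed
      qed
      also have "\<dots> \<le> (1 + q * t) * S" by (rule integral_gm_perturbed_le(2)[OF U v t])
      finally show ?thesis .
    qed
    have "(\<lambda>n. (\<integral>x. gm (U n) x \<partial>M) + t powr q * \<delta> - (\<integral>x. \<bar>gm (U n) x - F x\<bar> \<partial>M))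
        \<longlonglongrightarrow> S + t powr q * \<delta> - 0"
      by (intro tendsto_intros U_lim L1)
    then have "S + t powr q * \<delta> - 0 \<le> (1 + q * t) * S"
      by (rule LIMSEQ_le_const2) (use bound in auto)
    then show ?thesis by (simp add: algebra_simps)
  qed
  have S: "0 < S" using key[of 1] \<delta> q S_nonneg by (cases "S = 0") auto
  \<comment> \<open>the choice turns the estimate \<open>\<delta> \<le> q * S * t powr (1 - q)\<close> into \<open>\<delta> \<le> \<delta> / 2\<close>\<close>
  define t where "t = (\<delta> / (2 * q * S)) powr (1 / (1 - q))"
  have t: "0 < t" using \<delta> q S by (simp add: t_def)
  have "t powr q * \<delta> \<le> t powr q * (q * S * t powr (1 - q))"
  proof -
    have "t = t powr q * t powr (1 - q)" using t by (simp flip: powr_add)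
    then show ?thesis using key[OF t] by (simp add: mult_ac)
  qed
  then have "\<delta> \<le> q * S * t powr (1 - q)" using t by simp
  also have "t powr (1 - q) = \<delta> / (2 * q * S)"
    using \<delta> q S by (simp add: t_def powr_powr)
  also have "q * S * (\<delta> / (2 * q * S)) = \<delta> / 2" using q S by simp
  finally show False using \<delta> by simp
qed

text \<open>
  The first order condition for a maximiser. By Fatou's lemma the bound for perturbations of \<open>U n\<close>
  passes to the limit \<open>u\<close>. Instead of differentiating the product, it is bounded below: with
  \<open>r\<^sub>j = v\<^sub>j / u\<^sub>j\<close>, the inequality \<open>exp z \<ge> 1 + z\<close> gives
  \<open>gm (u + t v) \<ge> gm u * (1 + \<Sum>\<^sub>j b\<^sub>j ln (1 + t r\<^sub>j))\<close>. After division by \<open>t\<close> the logarithms tend to \<open>r\<^sub>j\<close> as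
  \<open>t\<close> tends to \<open>0\<close>, and a second application of Fatou's lemma gives the claim.
\<close>

theorem extremal_point:
  obtains u where "\<And>j. j \<in> J \<Longrightarrow> u j \<in> borel_measurable M" "\<And>j x. 0 < u j x"
    "integrable M (gm u)" "(\<integral>x. gm u x \<partial>M) = S" "0 < S"
    "\<And>v. v \<in> K \<Longrightarrow> (\<integral>\<^sup>+x. ennreal (gm u x * (\<Sum>j\<in>J. b j * (v j x / u j x))) \<partial>M) \<le> ennreal (q * S)"
proof -
  obtain U F where U: "\<And>n. U n \<in> K" and U_lim: "(\<lambda>n. \<integral>x. gm (U n) x \<partial>M) \<longlonglongrightarrow> S"
    and F: "integrable M F" "\<And>x. 0 \<le> F x" "(\<integral>x. F x \<partial>M) = S"
    and L1: "(\<lambda>n. \<integral>x. \<bar>gm (U n) x - F x\<bar> \<partial>M) \<longlonglongrightarrow> 0"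
    and coord: "AE x in M. 0 < F x \<longrightarrow> (\<forall>j\<in>J. \<exists>L>0. (\<lambda>n. U n j x) \<longlonglongrightarrow> L)"
    and conv: "AE x in M. (\<lambda>n. gm (U n) x) \<longlonglongrightarrow> F x"
    by (rule maximizing_sequence_converges) (rule that, assumption+)
  have F_pos: "AE x in M. 0 < F x" by (rule limit_positive[OF U U_lim F(1,2) L1])
  have S: "0 < S"
  proof -
    have "S \<noteq> 0"
    proof
      assume "S = 0"
      then have "AE x in M. F x = 0" using integral_nonneg_eq_0_iff_AE[OF F(1)] F by simp
      with F_pos have "AE x in M. False" by eventually_elim simp
      then show False using nontrivial_M AE_iff_measurable[of "space M" M "\<lambda>_. False"] by simp
    qed
    then show ?thesis using S_nonneg by simp
  qed
  \<comment> \<open>the value 1 on the exceptional null set keeps the quotients \<open>v j x / u j x\<close> meaningful everywhere\<close>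
  define u where "u j x = (let L = lim (\<lambda>n. U n j x) in if 0 < L then L else 1)" for j x
  have u_pos: "0 < u j x" for j x by (simp add: u_def Let_def)
  have u_meas: "u j \<in> borel_measurable M" if j: "j \<in> J" for j
  proof -
    have [measurable]: "U n j \<in> borel_measurable M" for n by (rule measurable_K[OF U j])
    show ?thesis unfolding u_def Let_def by measurable
  qed
  have u_lim: "AE x in M. \<forall>j\<in>J. (\<lambda>n. U n j x) \<longlonglongrightarrow> u j x"
    using coord F_pos
  proof eventually_elim
    case (elim x)
    show ?case
    proof
      fix j assume "j \<in> J"
      then obtain L where "0 < L" "(\<lambda>n. U n j x) \<longlonglongrightarrow> L" using elim by blast
      then show "(\<lambda>n. U n j x) \<longlonglongrightarrow> u j x" by (simp add: u_def limI)
    qed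
  qed
  have gm_lim: "(\<lambda>n. gm (\<lambda>j x. U n j x + t * v j x) x) \<longlonglongrightarrow> gm (\<lambda>j x. u j x + t * v j x) x"
    if "\<forall>j\<in>J. (\<lambda>n. U n j x) \<longlonglongrightarrow> u j x" "\<forall>j\<in>J. 0 \<le> t * v j x" for t v x
    unfolding gm_def weighted_prod_def using that u_pos[of _ x]
    by (intro tendsto_intros) (auto simp: add_pos_nonneg order_less_imp_not_eq2)
  have gm_u: "AE x in M. gm u x = F x"
    using conv u_lim
  proof eventually_elim
    case (elim x)
    from gm_lim[OF elim(2), of 0 "\<lambda>_ _. 0"] have "(\<lambda>n. gm (U n) x) \<longlonglongrightarrow> gm u x" by simp
    then show ?case using elim(1) by (rule LIMSEQ_unique)
  qed
  have gm_u_meas: "gm u \<in> borel_measurable M" by (intro measurable_gm u_meas)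
  have [measurable]: "F \<in> borel_measurable M" using F(1) by blast
  have u_int: "integrable M (gm u)"
    using integrable_cong_AE[OF gm_u_meas _ gm_u] F(1) by simp
  have u_S: "(\<integral>x. gm u x \<partial>M) = S"
    using integral_cong_AE[OF gm_u_meas _ gm_u] F(3) by simp
  have deriv: "(\<integral>\<^sup>+x. ennreal (gm u x * (\<Sum>j\<in>J. b j * (v j x / u j x))) \<partial>M) \<le> ennreal (q * S)"
    if v: "v \<in> K" for v
  proof -
    have v0: "0 \<le> v j x" if "j \<in> J" for j x by (rule nonneg_K[OF v that])
    have v_meas: "v j \<in> borel_measurable M" if "j \<in> J" for j by (rule measurable_K[OF v that])
    define D where "D t x = gm u x * (\<Sum>j\<in>J. b j * (ln (1 + t * (v j x / u j x)) / t))" for t x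
    have D0: "0 \<le> D t x" if "0 < t" for t x
      unfolding D_def using that v0 u_pos b_nonneg
      by (intro mult_nonneg_nonneg sum_nonneg divide_nonneg_pos ln_ge_zero gm_nonneg) (auto simp: less_imp_le)
    have D_meas: "D t \<in> borel_measurable M" for t
      unfolding D_def using u_meas v_meas
      by (intro borel_measurable_times gm_u_meas borel_measurable_sum borel_measurable_divide borel_measurable_ln
          borel_measurable_add borel_measurable_const)
    have gm_ge: "gm u x + t * D t x \<le> gm (\<lambda>j x. u j x + t * v j x) x" if t: "0 < t" for t x
    proof -
      define r where "r j = 1 + t * (v j x / u j x)" for j
      have r: "0 < r j" if "j \<in> J" for j
        unfolding r_def using t v0[OF that, of x] u_pos[of j x] by (intro add_pos_nonneg) (auto simp: less_imp_le)
      have "gm (\<lambda>j x. u j x + t * v j x) x = weighted_prod J b (\<lambda>j. u j x * r j)"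
        unfolding gm_def r_def using u_pos[of _ x]
        by (intro weighted_prod_cong) (simp add: distrib_left order_less_imp_not_eq2)
      also have "\<dots> = gm u x * weighted_prod J b r"
        unfolding gm_def using r u_pos by (intro weighted_prod_mult) (auto simp: less_imp_le)
      also have "\<dots> = gm u x * exp (\<Sum>j\<in>J. b j * ln (r j))"
        using weighted_prod_eq_exp[OF finite_J r] by simp
      also have "\<dots> \<ge> gm u x * (1 + (\<Sum>j\<in>J. b j * ln (r j)))"
        by (intro mult_left_mono gm_nonneg) simp
      also have "gm u x * (1 + (\<Sum>j\<in>J. b j * ln (r j))) = gm u x + t * D t x"
        unfolding D_def r_def using t
        by (simp add: distrib_left sum_distrib_left mult.left_commute)
      finally show ?thesis by simp
    qed
    have D_le: "(\<integral>\<^sup>+x. ennreal (D t x) \<partial>M) \<le> ennreal (q * S)" if t: "0 < t" for t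
    proof -
      have "(\<integral>\<^sup>+x. ennreal (gm (\<lambda>j x. u j x + t * v j x) x) \<partial>M)
          \<le> (\<integral>\<^sup>+x. liminf (\<lambda>n. ennreal (gm (\<lambda>j x. U n j x + t * v j x) x)) \<partial>M)"
      proof (rule nn_integral_mono_AE)
        show "AE x in M. ennreal (gm (\<lambda>j x. u j x + t * v j x) x)
            \<le> liminf (\<lambda>n. ennreal (gm (\<lambda>j x. U n j x + t * v j x) x))"
          using u_lim
        proof eventually_elim
          case (elim x)
          have "(\<lambda>n. ennreal (gm (\<lambda>j x. U n j x + t * v j x) x))
              \<longlonglongrightarrow> ennreal (gm (\<lambda>j x. u j x + t * v j x) x)"
            using elim t v0 by (intro tendsto_ennrealI gm_lim) auto
          then show ?case by (simp add: lim_imp_Liminf)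
        qed
      qed
      also have "\<dots> \<le> liminf (\<lambda>n. \<integral>\<^sup>+x. ennreal (gm (\<lambda>j x. U n j x + t * v j x) x) \<partial>M)"
        using integral_gm_perturbed_le(1)[OF U v t] by (intro nn_integral_liminf) auto
      also have "\<dots> \<le> liminf (\<lambda>n. ennreal ((1 + q * t) * S))"
      proof (intro Liminf_mono always_eventually allI)
        fix n
        have "(\<integral>\<^sup>+x. ennreal (gm (\<lambda>j x. U n j x + t * v j x) x) \<partial>M)
            = ennreal (\<integral>x. gm (\<lambda>j x. U n j x + t * v j x) x \<partial>M)"
          by (intro nn_integral_eq_integral integral_gm_perturbed_le(1)[OF U v t]) (simp add: gm_nonneg)
        also have "\<dots> \<le> ennreal ((1 + q * t) * S)"
          by (intro ennreal_leI integral_gm_perturbed_le(2)[OF U v t])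
        finally show "(\<integral>\<^sup>+x. ennreal (gm (\<lambda>j x. U n j x + t * v j x) x) \<partial>M) \<le> ennreal ((1 + q * t) * S)" .
      qed
      also have "\<dots> = ennreal ((1 + q * t) * S)" by (simp add: Liminf_const)
      finally have up: "(\<integral>\<^sup>+x. ennreal (gm (\<lambda>j x. u j x + t * v j x) x) \<partial>M) \<le> ennreal ((1 + q * t) * S)" .
      have "ennreal S + ennreal t * (\<integral>\<^sup>+x. ennreal (D t x) \<partial>M)
          = (\<integral>\<^sup>+x. ennreal (gm u x) \<partial>M) + (\<integral>\<^sup>+x. ennreal t * ennreal (D t x) \<partial>M)"
        using D_meas nn_integral_eq_integral[OF u_int] u_S by (simp add: gm_nonneg nn_integral_cmult)
      also have "\<dots> = (\<integral>\<^sup>+x. ennreal (gm u x + t * D t x) \<partial>M)"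
        using D0[OF t] t gm_nonneg[of u] D_meas gm_u_meas
        by (subst nn_integral_add[symmetric]) (auto simp: ennreal_mult' ennreal_plus)
      also have "\<dots> \<le> ennreal ((1 + q * t) * S)"
        using gm_ge[OF t] by (intro order_trans[OF nn_integral_mono up] ennreal_leI)
      also have "\<dots> = ennreal S + ennreal t * ennreal (q * S)"
      proof -
        have "(1 + q * t) * S = S + t * (q * S)" by (simp add: algebra_simps)
        then have "ennreal ((1 + q * t) * S) = ennreal S + ennreal (t * (q * S))"
          using S q t by (simp only:) (rule ennreal_plus; simp)
        also have "ennreal (t * (q * S)) = ennreal t * ennreal (q * S)"
          using t by (intro ennreal_mult') simp
        finally show ?thesis .
      qed
      finally have "ennreal S + ennreal t * (\<integral>\<^sup>+x. ennreal (D t x) \<partial>M)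
          \<le> ennreal S + ennreal t * ennreal (q * S)" .
      then have "ennreal t * (\<integral>\<^sup>+x. ennreal (D t x) \<partial>M) \<le> ennreal t * ennreal (q * S)"
        unfolding ennreal_add_left_cancel_le by (elim disjE) (simp_all only: infinity_ennreal_def ennreal_neq_top)
      then show ?thesis using t by (simp add: ennreal_mult_le_mult_iff)
    qed
    define \<tau> where "\<tau> n = inverse (real (Suc n))" for n
    have \<tau>: "0 < \<tau> n" for n by (simp add: \<tau>_def)
    have \<tau>_lim: "\<tau> \<longlonglongrightarrow> 0" unfolding \<tau>_def by (rule LIMSEQ_inverse_real_of_nat)
    have D_lim: "(\<lambda>n. D (\<tau> n) x) \<longlonglongrightarrow> gm u x * (\<Sum>j\<in>J. b j * (v j x / u j x))" for x
    proof -
      have "(\<lambda>n. ln (1 + \<tau> n * r) / \<tau> n) \<longlonglongrightarrow> r" if r: "0 \<le> r" for r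
      proof -
        have "((\<lambda>t. ln (1 + t * r)) has_real_derivative r) (at 0)"
          by (auto intro!: derivative_eq_intros)
        then have "((\<lambda>t. ln (1 + t * r) / t) \<longlongrightarrow> r) (at 0)"
          by (simp add: DERIV_def)
        moreover have "filterlim \<tau> (at 0) sequentially"
          by (rule filterlim_atI[OF \<tau>_lim]) (use \<tau> in \<open>simp add: order_less_imp_not_eq2\<close>)
        ultimately show ?thesis by (rule filterlim_compose)
      qed
      then show ?thesis
        unfolding D_def using v0 u_pos
        by (intro tendsto_mult_left tendsto_sum) (simp add: less_imp_le del: times_divide_eq_right)
    qed
    have "(\<integral>\<^sup>+x. ennreal (gm u x * (\<Sum>j\<in>J. b j * (v j x / u j x))) \<partial>M)
        = (\<integral>\<^sup>+x. liminf (\<lambda>n. ennreal (D (\<tau> n) x)) \<partial>M)"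
      by (intro nn_integral_cong lim_imp_Liminf[symmetric] tendsto_ennrealI D_lim) simp
    also have "\<dots> \<le> liminf (\<lambda>n. \<integral>\<^sup>+x. ennreal (D (\<tau> n) x) \<partial>M)"
      using D_meas by (intro nn_integral_liminf) auto
    also have "\<dots> \<le> liminf (\<lambda>n. ennreal (q * S))"
      using D_le[OF \<tau>] by (intro Liminf_mono always_eventually) auto
    also have "\<dots> = ennreal (q * S)" by (simp add: Liminf_const)
    finally show ?thesis .
  qed
  show thesis by (rule that[OF u_meas u_pos u_int u_S S deriv])
qed

end

section \<open>Positive cones and extended powers\<close>

context normed_lattice
begin

lemma carrier_vorder: "carrier (vorder Y) = carrier Y" and le_vorder: "le (vorder Y) = vle Y"
  by (simp_all add: vorder_def)

lemma smult_closed_real: "f \<in> carrier Y \<Longrightarrow> c \<odot>\<^bsub>Y\<^esub> f \<in> carrier Y"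
  by (rule smult_closed) (simp_all add: ring_of_type_algebra_def)

lemma zero_mem_cone: "\<zero>\<^bsub>Y\<^esub> \<in> positive_cone Y"
  using le_refl[of "\<zero>\<^bsub>Y\<^esub>"] by (simp add: positive_cone_def carrier_vorder le_vorder)

lemma add_mem_cone:
  assumes "f \<in> positive_cone Y" "g \<in> positive_cone Y"
  shows "f \<oplus>\<^bsub>Y\<^esub> g \<in> positive_cone Y"
proof -
  have f: "f \<in> carrier Y" "vle Y \<zero>\<^bsub>Y\<^esub> f" and g: "g \<in> carrier Y" "vle Y \<zero>\<^bsub>Y\<^esub> g"
    using assms by (auto simp: positive_cone_def)
  have "vle Y (\<zero>\<^bsub>Y\<^esub> \<oplus>\<^bsub>Y\<^esub> g) (f \<oplus>\<^bsub>Y\<^esub> g)" using f g by (intro vle_add) auto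
  then have "vle Y \<zero>\<^bsub>Y\<^esub> (f \<oplus>\<^bsub>Y\<^esub> g)"
    using le_trans[of "\<zero>\<^bsub>Y\<^esub>" g "f \<oplus>\<^bsub>Y\<^esub> g"] f g by (simp add: carrier_vorder le_vorder)
  then show ?thesis using f g by (simp add: positive_cone_def)
qed

lemma smult_mem_cone:
  assumes "f \<in> positive_cone Y" "0 \<le> c"
  shows "c \<odot>\<^bsub>Y\<^esub> f \<in> positive_cone Y"
proof -
  have f: "f \<in> carrier Y" "vle Y \<zero>\<^bsub>Y\<^esub> f" using assms by (auto simp: positive_cone_def)
  have "vle Y (c \<odot>\<^bsub>Y\<^esub> \<zero>\<^bsub>Y\<^esub>) (c \<odot>\<^bsub>Y\<^esub> f)" using f assms by (intro vle_smult) auto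
  moreover have "c \<odot>\<^bsub>Y\<^esub> \<zero>\<^bsub>Y\<^esub> = \<zero>\<^bsub>Y\<^esub>"
    by (rule smult_r_null) (simp add: ring_of_type_algebra_def)
  ultimately show ?thesis using smult_closed_real[OF f(1)] by (simp add: positive_cone_def)
qed

lemma zero_smult: "f \<in> carrier Y \<Longrightarrow> 0 \<odot>\<^bsub>Y\<^esub> f = \<zero>\<^bsub>Y\<^esub>"
  using smult_l_null[of f] by (simp add: ring_of_type_algebra_def)

lemma vnorm_zero: "vnorm Y \<zero>\<^bsub>Y\<^esub> = 0"
  using vnorm_eq_0[of "\<zero>\<^bsub>Y\<^esub>"] by simp

end

lemma positive_coneD: "f \<in> positive_cone Y \<Longrightarrow> f \<in> carrier Y"
  by (simp add: positive_cone_def)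

lemma positive_linear_mapD:
  assumes "positive_linear_map M Y T"
  shows "f \<in> carrier Y \<Longrightarrow> T f \<in> borel_measurable M"
    and "f \<in> carrier Y \<Longrightarrow> g \<in> carrier Y \<Longrightarrow> AE x in M. T (f \<oplus>\<^bsub>Y\<^esub> g) x = T f x + T g x"
    and "f \<in> carrier Y \<Longrightarrow> AE x in M. T (c \<odot>\<^bsub>Y\<^esub> f) x = c * T f x"
    and "f \<in> positive_cone Y \<Longrightarrow> AE x in M. 0 \<le> T f x"
  using assms by (auto simp: positive_linear_map_def)

lemma epowr_ennreal_pos:
  assumes "0 < p" "0 \<le> a"
  shows "epowr (ennreal a) p = ennreal (a powr p)"
  using assms by (auto simp: epowr_def)

lemma epowr_le_imp_le:
  assumes p: "0 < p" and B: "0 \<le> B" and le: "epowr I (1 / p) \<le> ennreal B"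
  shows "I \<le> ennreal (B powr p)"
proof (cases I)
  case (real r)
  then have "ennreal (r powr (1 / p)) \<le> ennreal B" using le epowr_ennreal_pos[of "1 / p" r] p by simp
  then have "r powr (1 / p) \<le> B" using B by (simp add: ennreal_le_iff)
  then have "(r powr (1 / p)) powr p \<le> B powr p" using p by (intro powr_mono2) auto
  then show ?thesis using real p by (simp add: powr_powr ennreal_leI)
next
  case top
  then show ?thesis using le p by (simp add: epowr_def top_unique)
qed

lemma nn_integral_powr_le_of_Lp_norm:
  assumes "0 < p" "0 \<le> B" "\<And>x. 0 \<le> g x" "Lp_norm M p g \<le> ennreal B"
  shows "(\<integral>\<^sup>+x. ennreal (g x powr p) \<partial>M) \<le> ennreal (B powr p)"
  using assms by (intro epowr_le_imp_le) (auto simp: Lp_norm_def epowr_ennreal_pos)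

lemma Lp_norm_eq_1:
  assumes p: "p \<noteq> 0" and g: "\<And>x. 0 < g x" and int: "(\<integral>\<^sup>+x. ennreal (g x powr p) \<partial>M) = 1"
  shows "Lp_norm M p g = 1"
proof -
  have "epowr (ennreal (g x)) p = ennreal (g x powr p)" for x
    using p g[of x] by (auto simp: epowr_def ennreal_eq_0_iff)
  then show ?thesis using int p by (simp add: Lp_norm_def epowr_def)
qed

section \<open>Images of the normalised positive tuples\<close>

locale saturating_positive_maps =
  fixes M :: "'a measure" and J :: "'i set" and Y :: "'i \<Rightarrow> 'b normed_vlattice"
    and T :: "'i \<Rightarrow> 'b \<Rightarrow> 'a \<Rightarrow> real" and \<alpha> :: "'i \<Rightarrow> real"
  assumes finite_J: "finite J"
    and lattice: "j \<in> J \<Longrightarrow> normed_lattice (Y j)"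
    and positive: "j \<in> J \<Longrightarrow> positive_linear_map M (Y j) (T j)"
    and saturating: "j \<in> J \<Longrightarrow> saturates M (Y j) (T j)"
    and \<alpha>_pos: "j \<in> J \<Longrightarrow> 0 < \<alpha> j"
begin

definition cost :: "('i \<Rightarrow> 'b) \<Rightarrow> real" where
  "cost f = (\<Sum>j\<in>J. \<alpha> j * vnorm (Y j) (f j))"

text \<open>
  Almost everywhere equality, and not equality, with the images is needed for convexity, because the maps
  are additive only up to null sets. Nonnegativity is imposed everywhere.
\<close>

definition images :: "('i \<Rightarrow> 'a \<Rightarrow> real) set" where
  "images = {u. (\<forall>j\<in>J. u j \<in> borel_measurable M \<and> (\<forall>x. 0 \<le> u j x)) \<and>
     (\<exists>f. (\<forall>j\<in>J. f j \<in> positive_cone (Y j) \<and> (AE x in M. u j x = T j (f j) x)) \<and> cost f \<le> 1)}"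

lemma positive_part_mem_images:
  assumes f: "\<And>j. j \<in> J \<Longrightarrow> f j \<in> positive_cone (Y j)" and "cost f \<le> 1"
  shows "(\<lambda>j x. max 0 (T j (f j) x)) \<in> images"
proof -
  have "AE x in M. max 0 (T j (f j) x) = T j (f j) x" if "j \<in> J" for j
    using positive_linear_mapD(4)[OF positive[OF that] f[OF that]] by eventually_elim simp
  moreover have "(\<lambda>x. max 0 (T j (f j) x)) \<in> borel_measurable M" if "j \<in> J" for j
    using positive_linear_mapD(1)[OF positive[OF that] positive_coneD[OF f[OF that]]] by measurable
  ultimately show ?thesis using assms unfolding images_def by auto
qed

lemma cost_smult:
  assumes "\<And>j. j \<in> J \<Longrightarrow> f j \<in> carrier (Y j)" "0 \<le> c"
  shows "cost (\<lambda>j. c \<odot>\<^bsub>Y j\<^esub> f j) = c * cost f"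
  unfolding cost_def sum_distrib_left using assms
  by (intro sum.cong) (auto simp: normed_lattice.vnorm_smult[OF lattice])

lemma cost_nonneg:
  assumes "\<And>j. j \<in> J \<Longrightarrow> f j \<in> carrier (Y j)"
  shows "0 \<le> cost f"
  unfolding cost_def using assms \<alpha>_pos
  by (intro sum_nonneg mult_nonneg_nonneg normed_lattice.vnorm_nonneg[OF lattice]) (auto intro: less_imp_le)

lemma convex_images:
  assumes u: "u \<in> images" and v: "v \<in> images" and s: "0 < s" and t: "0 < t" and st: "s + t = 1"
  shows "(\<lambda>j x. s * u j x + t * v j x) \<in> images"
proof -
  obtain f where f: "\<And>j. j \<in> J \<Longrightarrow> f j \<in> positive_cone (Y j)" "cost f \<le> 1"
    and fu: "\<And>j. j \<in> J \<Longrightarrow> AE x in M. u j x = T j (f j) x"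
    using u by (auto simp: images_def)
  obtain g where g: "\<And>j. j \<in> J \<Longrightarrow> g j \<in> positive_cone (Y j)" "cost g \<le> 1"
    and gv: "\<And>j. j \<in> J \<Longrightarrow> AE x in M. v j x = T j (g j) x"
    using v by (auto simp: images_def)
  define h where "h j = (s \<odot>\<^bsub>Y j\<^esub> f j) \<oplus>\<^bsub>Y j\<^esub> (t \<odot>\<^bsub>Y j\<^esub> g j)" for j
  have sf: "s \<odot>\<^bsub>Y j\<^esub> f j \<in> positive_cone (Y j)" and tg: "t \<odot>\<^bsub>Y j\<^esub> g j \<in> positive_cone (Y j)" if "j \<in> J" for j
    using f(1)[OF that] g(1)[OF that] s t by (auto intro!: normed_lattice.smult_mem_cone[OF lattice[OF that]])
  have h: "h j \<in> positive_cone (Y j)" if "j \<in> J" for j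
    unfolding h_def by (rule normed_lattice.add_mem_cone[OF lattice sf tg]) (rule that)+
  have Th: "AE x in M. s * u j x + t * v j x = T j (h j) x" if j: "j \<in> J" for j
    using fu[OF j] gv[OF j]
      positive_linear_mapD(2)[OF positive[OF j] positive_coneD[OF sf[OF j]] positive_coneD[OF tg[OF j]]]
      positive_linear_mapD(3)[OF positive[OF j] positive_coneD[OF f(1)[OF j]], of s]
      positive_linear_mapD(3)[OF positive[OF j] positive_coneD[OF g(1)[OF j]], of t]
    unfolding h_def by eventually_elim simp
  have "cost h \<le> cost (\<lambda>j. s \<odot>\<^bsub>Y j\<^esub> f j) + cost (\<lambda>j. t \<odot>\<^bsub>Y j\<^esub> g j)"
    unfolding cost_def sum.distrib[symmetric] distrib_left[symmetric] h_def
    using \<alpha>_pos sf tg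
    by (intro sum_mono mult_left_mono normed_lattice.vnorm_triangle[OF lattice]) (auto intro: positive_coneD less_imp_le)
  also have "\<dots> = s * cost f + t * cost g"
    using f g s t by (simp add: cost_smult positive_coneD)
  also have "\<dots> \<le> s * 1 + t * 1"
    using f g s t by (intro add_mono mult_left_mono) auto
  finally have "cost h \<le> 1" using st by simp
  moreover have "\<forall>j\<in>J. (\<lambda>x. s * u j x + t * v j x) \<in> borel_measurable M \<and> (\<forall>x. 0 \<le> s * u j x + t * v j x)"
    using u v s t
    by (auto simp: images_def intro!: borel_measurable_add borel_measurable_times borel_measurable_const)
  ultimately show ?thesis using h Th unfolding images_def by blast
qed

text \<open>
  Saturation is a property of each map separately. Applying it successively inside the set found for
  the previous maps yields one set on which all images are positive; rescaling brings the cost below \<open>1\<close>.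
\<close>

lemma saturated_images:
  assumes E: "E \<in> sets M" "0 < emeasure M E"
  shows "\<exists>u\<in>images. \<exists>E'\<in>sets M. E' \<subseteq> E \<and> 0 < emeasure M E' \<and> (AE x in M. x \<in> E' \<longrightarrow> (\<forall>j\<in>J. 0 < u j x))"
proof -
  have "\<exists>E'\<in>sets M. E' \<subseteq> E \<and> 0 < emeasure M E' \<and>
      (\<exists>h. \<forall>j\<in>I. h j \<in> positive_cone (Y j) \<and> (AE x in M. x \<in> E' \<longrightarrow> 0 < T j (h j) x))"
    if "I \<subseteq> J" for I
    using finite_subset[OF that finite_J] that
  proof (induction I)
    case empty
    then show ?case using E by auto
  next
    case (insert i I)
    then have "I \<subseteq> J" by simp
    from insert.IH[OF this] obtain E1 h where E1: "E1 \<in> sets M" "E1 \<subseteq> E" "0 < emeasure M E1"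
      and h: "\<And>j. j \<in> I \<Longrightarrow> h j \<in> positive_cone (Y j)"
        "\<And>j. j \<in> I \<Longrightarrow> AE x in M. x \<in> E1 \<longrightarrow> 0 < T j (h j) x"
      by blast
    obtain E2 k where E2: "E2 \<in> sets M" "E2 \<subseteq> E1" "0 < emeasure M E2"
      and k: "k \<in> positive_cone (Y i)" "AE x in M. x \<in> E2 \<longrightarrow> 0 < T i k x"
      using saturating[of i] insert.prems E1 unfolding saturates_def by blast
    have "(h(i := k)) j \<in> positive_cone (Y j) \<and> (AE x in M. x \<in> E2 \<longrightarrow> 0 < T j ((h(i := k)) j) x)"
      if j: "j \<in> insert i I" for j
    proof (cases "j = i")
      case True
      then show ?thesis using k by simp
    next
      case False
      then have jI: "j \<in> I" using j by simp
      from h(2)[OF jI] have "AE x in M. x \<in> E2 \<longrightarrow> 0 < T j (h j) x"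
        by eventually_elim (use E2(2) in auto)
      then show ?thesis using h(1)[OF jI] False by simp
    qed
    then show ?case using E1 E2 by blast
  qed
  from this[OF subset_refl] obtain E' h where E': "E' \<in> sets M" "E' \<subseteq> E" "0 < emeasure M E'"
    and h: "\<And>j. j \<in> J \<Longrightarrow> h j \<in> positive_cone (Y j)"
      "\<And>j. j \<in> J \<Longrightarrow> AE x in M. x \<in> E' \<longrightarrow> 0 < T j (h j) x"
    by blast
  define c where "c = 1 / (cost h + 1)"
  have ch: "0 \<le> cost h" using h by (intro cost_nonneg positive_coneD)
  have c: "0 < c" using ch by (simp add: c_def)
  have cone: "c \<odot>\<^bsub>Y j\<^esub> h j \<in> positive_cone (Y j)" if "j \<in> J" for j
    using c h(1)[OF that] by (intro normed_lattice.smult_mem_cone[OF lattice[OF that]]) auto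
  have "cost (\<lambda>j. c \<odot>\<^bsub>Y j\<^esub> h j) = c * cost h"
    using c h(1) by (intro cost_smult) (auto intro: positive_coneD)
  also have "\<dots> \<le> 1" using ch by (simp add: c_def field_simps)
  finally have mem: "(\<lambda>j x. max 0 (T j (c \<odot>\<^bsub>Y j\<^esub> h j) x)) \<in> images"
    using cone by (intro positive_part_mem_images)
  have "AE x in M. x \<in> E' \<longrightarrow> 0 < max 0 (T j (c \<odot>\<^bsub>Y j\<^esub> h j) x)" if j: "j \<in> J" for j
    using h(2)[OF j] positive_linear_mapD(3)[OF positive[OF j] positive_coneD[OF h(1)[OF j]], of c]
    by eventually_elim (use c in auto)
  then have "AE x in M. \<forall>j\<in>J. x \<in> E' \<longrightarrow> 0 < max 0 (T j (c \<odot>\<^bsub>Y j\<^esub> h j) x)"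
    by (intro AE_finite_allI finite_J)
  then have "AE x in M. x \<in> E' \<longrightarrow> (\<forall>j\<in>J. 0 < max 0 (T j (c \<odot>\<^bsub>Y j\<^esub> h j) x))"
    by eventually_elim simp
  with mem E' show ?thesis by (intro bexI[OF _ mem] bexI[OF _ E'(1)] conjI)
qed

text \<open>
  On tuples of cost at most \<open>1\<close> the product of the norms in the hypothesis is at most \<open>1\<close>, by the inequality of
  arithmetic and geometric means.
\<close>

lemma images_bound:
  assumes q: "0 < q" and A: "0 \<le> A" and sum: "(\<Sum>j\<in>J. \<alpha> j) = 1"
    and bound: "\<And>f. (\<forall>j\<in>J. f j \<in> positive_cone (Y j)) \<Longrightarrow>
      Lp_norm M q (\<lambda>x. \<Prod>j\<in>J. T j (f j) x powr \<alpha> j)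
        \<le> ennreal (A * (\<Prod>j\<in>J. vnorm (Y j) (f j) powr \<alpha> j))"
    and u: "u \<in> images"
  shows "(\<integral>\<^sup>+x. ennreal (weighted_prod J (\<lambda>j. q * \<alpha> j) (\<lambda>j. u j x)) \<partial>M) \<le> ennreal (A powr q)"
proof -
  obtain f where f: "\<And>j. j \<in> J \<Longrightarrow> f j \<in> positive_cone (Y j)" "cost f \<le> 1"
    and fu: "\<And>j. j \<in> J \<Longrightarrow> AE x in M. u j x = T j (f j) x"
    using u by (auto simp: images_def)
  have "(\<Prod>j\<in>J. vnorm (Y j) (f j) powr \<alpha> j) \<le> cost f"
    using weighted_am_gm[of J \<alpha> "\<lambda>j. vnorm (Y j) (f j)"] finite_J \<alpha>_pos sum f(1)
      normed_lattice.vnorm_nonneg[OF lattice]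
    by (auto simp: weighted_prod_def cost_def less_imp_le positive_coneD)
  then have "A * (\<Prod>j\<in>J. vnorm (Y j) (f j) powr \<alpha> j) \<le> A"
    using f(2) A by (intro mult_left_le) auto
  then have "Lp_norm M q (\<lambda>x. \<Prod>j\<in>J. T j (f j) x powr \<alpha> j) \<le> ennreal A"
    using bound[of f] f(1) by (meson ennreal_leI order_trans)
  then have le: "(\<integral>\<^sup>+x. ennreal ((\<Prod>j\<in>J. T j (f j) x powr \<alpha> j) powr q) \<partial>M) \<le> ennreal (A powr q)"
    using q A by (intro nn_integral_powr_le_of_Lp_norm) (auto intro: prod_nonneg)
  have "AE x in M. \<forall>j\<in>J. u j x = T j (f j) x" using fu by (intro AE_finite_allI finite_J)
  then have "AE x in M. ennreal (weighted_prod J (\<lambda>j. q * \<alpha> j) (\<lambda>j. u j x))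
      = ennreal ((\<Prod>j\<in>J. T j (f j) x powr \<alpha> j) powr q)"
  proof eventually_elim
    case (elim x)
    have "(\<Prod>j\<in>J. T j (f j) x powr \<alpha> j) powr q = (\<Prod>j\<in>J. (T j (f j) x powr \<alpha> j) powr q)"
      by (rule prod_powr_distrib)
    then show ?case using elim by (simp add: weighted_prod_def powr_powr mult.commute)
  qed
  from nn_integral_cong_AE[OF this] le show ?thesis by simp
qed

end

section \<open>The factorisation\<close>

text \<open>
  With \<open>P = \<Prod>\<^sub>j u\<^sub>j powr \<alpha>\<^sub>j\<close> for the extremal tuple \<open>u\<close>, the integrand is \<open>P powr q\<close>, and
  \<open>g\<^sub>j = c * P powr q / u\<^sub>j\<close> has weighted product \<open>c * P powr (q - 1)\<close>. Its power with exponent \<open>q / (q - 1)\<close> is a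
  multiple of the integrable function \<open>P powr q\<close>, and \<open>c\<close> normalises the integral.
\<close>

theorem factorisation:
  fixes M :: "'a measure" and J :: "'i set" and Y :: "'i \<Rightarrow> 'b normed_vlattice"
    and T :: "'i \<Rightarrow> 'b \<Rightarrow> 'a \<Rightarrow> real" and \<alpha> :: "'i \<Rightarrow> real"
  assumes maps: "saturating_positive_maps M J Y T \<alpha>"
    and M: "emeasure M (space M) \<noteq> 0"
    and sum: "(\<Sum>j\<in>J. \<alpha> j) = 1" and q: "0 < q" "q < 1" and A: "0 \<le> A"
    and bound: "\<And>f. (\<forall>j\<in>J. f j \<in> positive_cone (Y j)) \<Longrightarrow>
      Lp_norm M q (\<lambda>x. \<Prod>j\<in>J. T j (f j) x powr \<alpha> j)
        \<le> ennreal (A * (\<Prod>j\<in>J. vnorm (Y j) (f j) powr \<alpha> j))"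
  obtains g where "\<And>j. j \<in> J \<Longrightarrow> g j \<in> borel_measurable M" "\<And>j x. 0 < g j x"
    "Lp_norm M (q / (q - 1)) (\<lambda>x. \<Prod>j\<in>J. g j x powr \<alpha> j) = 1"
    "\<And>j f. \<lbrakk>j \<in> J; f \<in> positive_cone (Y j)\<rbrakk> \<Longrightarrow>
      (\<integral>\<^sup>+x. ennreal (g j x * T j f x) \<partial>M) \<le> ennreal (A * vnorm (Y j) f)"
proof -
  interpret saturating_positive_maps M J Y T \<alpha> by (rule maps)
  define b where "b j = q * \<alpha> j" for j
  have sum_b: "(\<Sum>j\<in>J. b j) = q" using sum by (simp add: b_def sum_distrib_left[symmetric])
  have b_pos: "0 < b j" if "j \<in> J" for j using q \<alpha>_pos[OF that] by (simp add: b_def)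
  note im_bound = images_bound[OF q(1) A sum bound, folded b_def]
  interpret ext: bounded_convex_family M J b images
  proof
    show "finite J" by (rule finite_J)
    show "0 < b j" if "j \<in> J" for j by (rule b_pos[OF that])
    show "sum b J < 1" "0 < sum b J" using sum_b q by simp_all
    show "u j \<in> borel_measurable M" if "u \<in> images" "j \<in> J" for u j
      using that by (auto simp: images_def)
    show "0 \<le> u j x" if "u \<in> images" "j \<in> J" for u j x
      using that by (auto simp: images_def)
    show "(\<lambda>j x. s * u j x + t * v j x) \<in> images"
      if "u \<in> images" "v \<in> images" "0 < s" "0 < t" "s + t = 1" for u v s t
      using that by (rule convex_images)
    show "\<exists>B. \<forall>u\<in>images. (\<integral>\<^sup>+x. ennreal (weighted_prod J b (\<lambda>j. u j x)) \<partial>M) \<le> ennreal B"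
      using im_bound by blast
    show "\<exists>u\<in>images. \<exists>E'\<in>sets M. E' \<subseteq> E \<and> 0 < emeasure M E' \<and> (AE x in M. x \<in> E' \<longrightarrow> (\<forall>j\<in>J. 0 < u j x))"
      if "E \<in> sets M" "0 < emeasure M E" for E
      using that by (rule saturated_images)
    show "emeasure M (space M) \<noteq> 0" by (rule M)
  qed
  have ext_q: "ext.q = q" by (simp add: ext.q_def sum_b)
  obtain u where u_meas: "\<And>j. j \<in> J \<Longrightarrow> u j \<in> borel_measurable M" and u_pos: "\<And>j x. 0 < u j x"
    and u_int: "integrable M (ext.gm u)" "(\<integral>x. ext.gm u x \<partial>M) = ext.S" and S: "0 < ext.S"
    and opt: "\<And>v. v \<in> images \<Longrightarrow>
      (\<integral>\<^sup>+x. ennreal (ext.gm u x * (\<Sum>j\<in>J. b j * (v j x / u j x))) \<partial>M) \<le> ennreal (ext.q * ext.S)"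
    by (rule ext.extremal_point) (rule that, assumption+)
  define S where "S = ext.S"
  have S_pos: "0 < S" using S by (simp add: S_def)
  have S_le: "S \<le> A powr q"
    unfolding S_def ext.S_def
  proof (rule cSUP_least[OF ext.nonempty_K])
    fix v assume v: "v \<in> images"
    have "ennreal (\<integral>x. ext.gm v x \<partial>M) = (\<integral>\<^sup>+x. ennreal (ext.gm v x) \<partial>M)"
      by (rule nn_integral_eq_integral[symmetric, OF ext.integrable_gm[OF v]]) (simp add: ext.gm_nonneg)
    also have "\<dots> \<le> ennreal (A powr q)" using im_bound[OF _ v] by (simp add: ext.gm_def)
    finally show "(\<integral>x. ext.gm v x \<partial>M) \<le> A powr q" by (simp add: ennreal_le_iff)
  qed
  define c where "c = S powr ((1 - q) / q)"
  have c: "0 < c" using S_pos by (simp add: c_def)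
  have cS: "c * S \<le> A"
  proof -
    have "c * S = S powr ((1 - q) / q + 1)" using S_pos by (simp add: c_def powr_add)
    also have "(1 - q) / q + 1 = 1 / q" using q by (simp add: field_simps)
    also have "S powr (1 / q) \<le> (A powr q) powr (1 / q)" using S_le S_pos q by (intro powr_mono2) auto
    also have "\<dots> = A" using A q by (simp add: powr_powr)
    finally show ?thesis .
  qed
  define P where "P x = weighted_prod J \<alpha> (\<lambda>j. u j x)" for x
  have P: "0 < P x" for x unfolding P_def by (intro weighted_prod_pos u_pos)
  have gm_P: "ext.gm u x = P x powr q" for x
  proof -
    have "P x powr q = (\<Prod>j\<in>J. (u j x powr \<alpha> j) powr q)"
      unfolding P_def weighted_prod_def by (rule prod_powr_distrib)
    then show ?thesis by (simp add: ext.gm_def weighted_prod_def b_def powr_powr mult.commute)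
  qed
  have gm_pos: "0 < ext.gm u x" for x using P[of x] by (simp add: gm_P)
  define g where "g j x = c * ext.gm u x / u j x" for j x
  have g_pos: "0 < g j x" for j x using c gm_pos u_pos by (simp add: g_def)
  have gm_meas: "ext.gm u \<in> borel_measurable M" using u_int(1) by blast
  have g_meas: "g j \<in> borel_measurable M" if "j \<in> J" for j
    unfolding g_def using u_meas[OF that] gm_meas by measurable
  have g_prod: "(\<Prod>j\<in>J. g j x powr \<alpha> j) = c * P x powr (q - 1)" for x
  proof -
    have "(\<Prod>j\<in>J. g j x powr \<alpha> j) * P x = weighted_prod J \<alpha> (\<lambda>j. g j x * u j x)"
      using u_pos g_pos by (subst weighted_prod_mult) (auto simp: P_def weighted_prod_def less_imp_le)
    also have "\<dots> = weighted_prod J \<alpha> (\<lambda>j. (c * ext.gm u x) * 1)"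
      using u_pos[of _ x] by (intro weighted_prod_cong) (simp add: g_def order_less_imp_not_eq2)
    also have "\<dots> = c * ext.gm u x"
      using c gm_pos[of x] finite_J sum
      by (subst weighted_prod_scale) (auto simp: weighted_prod_def)
    also have "\<dots> = c * P x powr (q - 1) * P x"
      using P[of x] by (simp add: gm_P powr_diff)
    finally show ?thesis using P[of x] by simp
  qed
  show thesis
  proof (rule that[of g])
    show "Lp_norm M (q / (q - 1)) (\<lambda>x. \<Prod>j\<in>J. g j x powr \<alpha> j) = 1"
    proof (rule Lp_norm_eq_1)
      show "q / (q - 1) \<noteq> 0" using q by simp
      show "0 < (\<Prod>j\<in>J. g j x powr \<alpha> j)" for x using g_prod c P[of x] by simp
      have "(\<Prod>j\<in>J. g j x powr \<alpha> j) powr (q / (q - 1)) = 1 / S * ext.gm u x" for x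
      proof -
        have "(\<Prod>j\<in>J. g j x powr \<alpha> j) powr (q / (q - 1))
            = c powr (q / (q - 1)) * (P x powr (q - 1)) powr (q / (q - 1))"
          unfolding g_prod by (rule powr_mult)
        also have "(P x powr (q - 1)) powr (q / (q - 1)) = ext.gm u x"
          using q by (simp add: powr_powr gm_P)
        also have "c powr (q / (q - 1)) = 1 / S"
        proof -
          have "(1 - q) / q * (q / (q - 1)) = -1" using q by (simp add: field_simps)
          then show ?thesis using S_pos by (simp add: c_def powr_powr powr_minus_divide)
        qed
        finally show ?thesis .
      qed
      then have "(\<integral>\<^sup>+x. ennreal ((\<Prod>j\<in>J. g j x powr \<alpha> j) powr (q / (q - 1))) \<partial>M)
          = (\<integral>\<^sup>+x. ennreal (1 / S * ext.gm u x) \<partial>M)" by simp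
      also have "\<dots> = ennreal (\<integral>x. 1 / S * ext.gm u x \<partial>M)"
        using u_int(1) S_pos ext.gm_nonneg by (intro nn_integral_eq_integral) auto
      also have "\<dots> = 1" using u_int(2) S_pos by (simp add: S_def)
      finally show "(\<integral>\<^sup>+x. ennreal ((\<Prod>j\<in>J. g j x powr \<alpha> j) powr (q / (q - 1))) \<partial>M) = 1" .
    qed
    fix j f assume j: "j \<in> J" and f: "f \<in> positive_cone (Y j)"
    interpret Yj: normed_lattice "Y j" by (rule lattice[OF j])
    have fc: "f \<in> carrier (Y j)" by (rule positive_coneD[OF f])
    note pos_lin = positive_linear_mapD[OF positive[OF j]]
    show "(\<integral>\<^sup>+x. ennreal (g j x * T j f x) \<partial>M) \<le> ennreal (A * vnorm (Y j) f)"
    proof (cases "vnorm (Y j) f = 0")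
      case True
      then have "0 \<odot>\<^bsub>Y j\<^esub> f = f" using Yj.vnorm_eq_0[OF fc] Yj.zero_smult[OF fc] by simp
      then have "AE x in M. ennreal (g j x * T j f x) = 0"
        using pos_lin(3)[OF fc, of 0] by (auto elim: eventually_mono)
      then have "(\<integral>\<^sup>+x. ennreal (g j x * T j f x) \<partial>M) = (\<integral>\<^sup>+x. 0 \<partial>M)"
        by (rule nn_integral_cong_AE)
      then show ?thesis by simp
    next
      case False
      then have f_pos: "0 < vnorm (Y j) f" using Yj.vnorm_nonneg[OF fc] by simp
      \<comment> \<open>the competitor has only the \<open>j\<close>-th component, scaled to cost 1\<close>
      define r where "r = \<alpha> j * vnorm (Y j) f"
      have r: "0 < r" using f_pos \<alpha>_pos[OF j] by (simp add: r_def)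
      define h where "h k = (if k = j then (1 / r) \<odot>\<^bsub>Y j\<^esub> f else \<zero>\<^bsub>Y k\<^esub>)" for k
      define v where "v k x = max 0 (T k (h k) x)" for k x
      have cost_h: "cost h = 1"
      proof -
        have "cost h = (\<Sum>k\<in>J. if k = j then \<alpha> j * vnorm (Y j) ((1 / r) \<odot>\<^bsub>Y j\<^esub> f) else 0)"
          unfolding cost_def h_def
          by (intro sum.cong) (auto simp: normed_lattice.vnorm_zero[OF lattice])
        also have "\<dots> = 1"
          using j finite_J r f_pos \<alpha>_pos[OF j] by (simp add: Yj.vnorm_smult[OF fc] r_def)
        finally show ?thesis .
      qed
      have v: "v \<in> images"
        unfolding v_def
      proof (rule positive_part_mem_images)
        show "h k \<in> positive_cone (Y k)" if "k \<in> J" for k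
          unfolding h_def using r f Yj.smult_mem_cone normed_lattice.zero_mem_cone[OF lattice[OF that]]
          by simp
      qed (simp add: cost_h)
      have v0: "0 \<le> v k x" for k x by (simp add: v_def)
      have vj: "AE x in M. v j x = T j f x / r"
        using pos_lin(3)[OF fc, of "1 / r"] pos_lin(4)[OF f]
        by eventually_elim (use r in \<open>simp add: v_def h_def\<close>)
      define k where "k = c * r / b j"
      have k: "0 < k" using c r b_pos[OF j] by (simp add: k_def)
      have "(\<integral>\<^sup>+x. ennreal (g j x * T j f x) \<partial>M)
          \<le> (\<integral>\<^sup>+x. ennreal k * ennreal (ext.gm u x * (\<Sum>j\<in>J. b j * (v j x / u j x))) \<partial>M)"
      proof (rule nn_integral_mono_AE)
        show "AE x in M. ennreal (g j x * T j f x)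
            \<le> ennreal k * ennreal (ext.gm u x * (\<Sum>j\<in>J. b j * (v j x / u j x)))"
          using vj
        proof eventually_elim
          case (elim x)
          have "b j * (v j x / u j x) \<le> (\<Sum>j\<in>J. b j * (v j x / u j x))"
            using j finite_J b_pos v0 u_pos by (intro member_le_sum) (auto simp: less_imp_le)
          then have "k * (ext.gm u x * (b j * (v j x / u j x)))
              \<le> k * (ext.gm u x * (\<Sum>j\<in>J. b j * (v j x / u j x)))"
            using k gm_pos[of x] by (intro mult_left_mono) (auto simp: less_imp_le)
          moreover have "g j x * T j f x = k * (ext.gm u x * (b j * (v j x / u j x)))"
            using r b_pos[OF j] elim by (simp add: g_def k_def)
          ultimately show ?case
            using k by (subst ennreal_mult'[symmetric]) (simp_all add: ennreal_leI)
        qed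
      qed
      also have "\<dots> = ennreal k * (\<integral>\<^sup>+x. ennreal (ext.gm u x * (\<Sum>j\<in>J. b j * (v j x / u j x))) \<partial>M)"
      proof (rule nn_integral_cmult)
        have "v i \<in> borel_measurable M" if "i \<in> J" for i using ext.measurable_K[OF v that] .
        then show "(\<lambda>x. ennreal (ext.gm u x * (\<Sum>j\<in>J. b j * (v j x / u j x)))) \<in> borel_measurable M"
          using u_meas gm_meas
          by (intro measurable_compose[OF _ measurable_ennreal] borel_measurable_times borel_measurable_sum
              borel_measurable_divide borel_measurable_const)
      qed
      also have "\<dots> \<le> ennreal k * ennreal (q * S)"
        using opt[OF v] by (intro mult_left_mono) (auto simp: ext_q S_def)
      also have "\<dots> = ennreal (c * S * vnorm (Y j) f)"
      proof -
        have "k * (q * S) = c * S * vnorm (Y j) f"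
          using q \<alpha>_pos[OF j] by (simp add: k_def r_def b_def)
        then show ?thesis using k ennreal_mult'[of k "q * S"] by (simp only: less_imp_le)
      qed
      also have "\<dots> \<le> ennreal (A * vnorm (Y j) f)"
        using cS f_pos by (intro ennreal_leI mult_right_mono) auto
      finally show ?thesis .
    qed
  qed (use g_meas g_pos in auto)
qed

theorem theorem2p3:
  fixes M :: "'a measure"
    and d :: nat
    and Y :: "nat \<Rightarrow> 'b normed_vlattice"
    and T :: "nat \<Rightarrow> 'b \<Rightarrow> 'a \<Rightarrow> real"
    and \<alpha> :: "nat \<Rightarrow> real"
    and q A :: real
  assumes "sigma_finite_measure M"
    and "emeasure M (space M) \<noteq> 0"
    and "\<And>j. j \<in> {1..d} \<Longrightarrow> normed_lattice (Y j)"
    and "\<And>j. j \<in> {1..d} \<Longrightarrow> positive_linear_map M (Y j) (T j)"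
    and "\<And>j. j \<in> {1..d} \<Longrightarrow> saturates M (Y j) (T j)"
    and "\<And>j. j \<in> {1..d} \<Longrightarrow> 0 < \<alpha> j"
    and "(\<Sum>j=1..d. \<alpha> j) = 1"
    and "0 < q" and "q < 1"
    and "0 \<le> A"
    and "\<And>f. (\<forall>j\<in>{1..d}. f j \<in> positive_cone (Y j)) \<Longrightarrow>
           Lp_norm M q (\<lambda>x. \<Prod>j=1..d. T j (f j) x powr \<alpha> j)
             \<le> ennreal (A * (\<Prod>j=1..d. vnorm (Y j) (f j) powr \<alpha> j))"
  shows "\<exists>g :: nat \<Rightarrow> 'a \<Rightarrow> real.
           (\<forall>j\<in>{1..d}. g j \<in> borel_measurable M \<and> (\<forall>x\<in>space M. 0 \<le> g j x)) \<and>
           Lp_norm M (q / (q - 1)) (\<lambda>x. \<Prod>j=1..d. g j x powr \<alpha> j) = 1 \<and>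
           (\<forall>j\<in>{1..d}. \<forall>f\<in>positive_cone (Y j).
              (\<integral>\<^sup>+x. ennreal (g j x * T j f x) \<partial>M) \<le> ennreal (A * vnorm (Y j) f))"
proof -
  have maps: "saturating_positive_maps M {1..d} Y T \<alpha>"
    by (rule saturating_positive_maps.intro) (use assms(3-6) in auto)
  obtain g where "\<And>j. j \<in> {1..d} \<Longrightarrow> g j \<in> borel_measurable M" "\<And>j x. 0 < g j x"
    "Lp_norm M (q / (q - 1)) (\<lambda>x. \<Prod>j=1..d. g j x powr \<alpha> j) = 1"
    "\<And>j f. \<lbrakk>j \<in> {1..d}; f \<in> positive_cone (Y j)\<rbrakk> \<Longrightarrow>
      (\<integral>\<^sup>+x. ennreal (g j x * T j f x) \<partial>M) \<le> ennreal (A * vnorm (Y j) f)"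
    using factorisation[OF maps assms(2,7,8,9,10,11)] by blast
  then show ?thesis by (intro exI[of _ g]) (auto simp: less_imp_le)
qed

end
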